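(* Let $H$ be an $m\times n$ matrix with i.i.d. standard normal components. Let $n$ be large and let $m=\alpha n$, where $\alpha>0$ is a constant independent of $n$. Let $$\xi_n=\min_{\mathbf{x}\in\{-\frac{1}{\sqrt n},\frac{1}{\sqrt n}\}^n}\|H\mathbf{x}\|_2 .$$ Let $\epsilon_1^{(m)},\epsilon_1^{(n)},\epsilon_5^{(g)}>0$ be arbitrarily small constants independent of $n$, and let $\xi_n^{(l)}$ be a scalar such that $$(1-\epsilon_1^{(m)})\sqrt{\alpha}-(1+\epsilon_1^{(n)})\sqrt{\frac{2}{\pi}}-\epsilon_5^{(g)}>\frac{\xi_n^{(l)}}{\sqrt n}.$$ Then $$\lim_{n\to\infty}P\Big(\min_{\mathbf{x}\in\{-\frac{1}{\sqrt n},\frac{1}{\sqrt n}\}^n}\|H\mathbf{x}\|_2\ge \xi_n^{(l)}\Big)\ge 1\ \Leftrightarrow\ \lim_{n\to\infty}P\big(\xi_n\ge \xi_n^{(l)}\big)\ge 1\ \Leftrightarrow\ \lim_{n\to\infty}P\big(\xi_n^2\ge (\xi_n^{(l)})^2\big)\ge 1$$ (these equivalent statements are asserted to hold), and $$\frac{E\xi_n}{\sqrt n}=\frac{E\big(\min_{\mathbf{x}\in\{-\frac{1}{\sqrt n},\frac{1}{\sqrt n}\}^n}\|H\mathbf{x}\|_2\big)}{\sqrt n}\ge \sqrt{\alpha}-\frac{1}{4\sqrt{mn}}-\sqrt{\frac{2}{\pi}} .$$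
   Context: $\|\cdot\|_2$ is the Euclidean norm, $E$ denotes expectation and $P$ probability. A probability limit being $\ge 1$ means that it equals $1$. The subscript $n$ in $\xi_n$ and $\xi_n^{(l)}$ stands for "negative" (the negative Hopfield form), not only for the dimension.
   Formalization: The equivalence with the squared statement is given only when ξ_n^(l) ≥ 0 for all large n, since it fails for very negative ξ_n^(l) (e.g. −1000(1+√α)√n); m = αn is read as m = ⌈αn⌉. *)

theory Defs
  imports "HOL-Probability.Probability"
begin

text \<open>
  Matrices and vectors whose size varies with \<open>n\<close> are functions on indices; only the entries
  with row index below \<open>m\<close> and column index below \<open>n\<close> are meaningful.
\<close>

definition mat_vec :: "nat \<Rightarrow> (nat \<Rightarrow> nat \<Rightarrow> real) \<Rightarrow> (nat \<Rightarrow> real) \<Rightarrow> nat \<Rightarrow> real" where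
  "mat_vec n A x i = (\<Sum>j<n. A i j * x j)"

definition eucl_norm :: "nat \<Rightarrow> (nat \<Rightarrow> real) \<Rightarrow> real" where
  "eucl_norm m v = L2_set v {..<m}"

text \<open>Extensional functions are used so that the cube is a finite set with \<open>2 ^ n\<close> elements.\<close>

definition sign_cube :: "nat \<Rightarrow> (nat \<Rightarrow> real) set" where
  "sign_cube n = ({..<n} \<rightarrow>\<^sub>E {- 1 / sqrt (real n), 1 / sqrt (real n)})"

definition std_normal_matrix ::
    "'a measure \<Rightarrow> nat \<Rightarrow> nat \<Rightarrow> (nat \<Rightarrow> nat \<Rightarrow> 'a \<Rightarrow> real) \<Rightarrow> bool" where
  "std_normal_matrix M m n H \<longleftrightarrow>
     prob_space M \<and>
     prob_space.indep_vars M (\<lambda>_. borel) (\<lambda>(i, j). H i j) ({..<m} \<times> {..<n}) \<and>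
     (\<forall>i<m. \<forall>j<n. distributed M lborel (H i j) std_normal_density)"

end

theory Submission imports Defs begin

text \<open>
  The lower bound is Gordon's comparison between a bilinear and a linear Gaussian process. For a
  fixed unit vector \<open>x\<close>, the vector \<open>H x\<close> is a standard Gaussian vector; the comparison shows that,
  as far as the minimum over \<open>x\<close> is concerned, \<open>\<parallel>H x\<parallel> + g\<^sub>0\<close>, with one extra independent standard
  Gaussian \<open>g\<^sub>0\<close>, is stochastically larger than \<open>\<parallel>g\<parallel> + h \<bullet> x\<close>, where \<open>g\<close> and \<open>h\<close> are independent
  standard Gaussian vectors of dimensions \<open>m\<close> and \<open>n\<close>. On the cube the minimum of the second process
  is explicit: it is \<open>\<parallel>g\<parallel> - (\<Sum>j. \<bar>h\<^sub>j\<bar>) / sqrt n\<close>.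

  The comparison (\<open>gordon_comparison\<close>) is proved by rotating one process into the other. All
  variables are placed in one Gaussian matrix with \<open>m + 1\<close> rows and \<open>n + 1\<close> columns; at angle \<open>\<theta>\<close> the
  process consists of linear forms whose covariances are known, and the expectation of a product of
  increasing functions of the process is monotone in \<open>\<theta>\<close> (\<open>gordon_interpolation_mono\<close>). The derivative
  is computed by Gaussian integration by parts along a direction
  (\<open>gauss_prod_integration_by_parts\<close>), which is itself the infinitesimal form of the Cameron-Martin
  translation formula. Two features make the sign visible: along the direction attached to \<open>x\<close>
  the process at \<open>x\<close> does not change, so that only pairs \<open>x \<noteq> y\<close> contribute, and each pair contributes a
  nonnegative multiple of \<open>(1 - x \<bullet> y) (1 - u \<bullet> v)\<close> with vectors \<open>u\<close> and \<open>v\<close> of norm at most one.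

  Taking expectations removes \<open>g\<^sub>0\<close> and leaves the expected norm of \<open>g\<close>, minus \<open>sqrt n * sqrt (2 / pi)\<close>.
  In polar coordinates the expected norm is a quotient of consecutive absolute moments of one
  Gaussian variable, hence the product of the expected norms in dimensions \<open>m\<close> and \<open>m + 1\<close> is \<open>m\<close>;
  together with the trivial upper bound \<open>sqrt m\<close> this recursion forces the expected norm to be at
  least \<open>sqrt m - 1 / (4 sqrt m)\<close> (\<open>lower_bound_from_product_recursion\<close>). The same bound
  shows that the norm of \<open>g\<close> has variance at most \<open>1 / 2\<close>.

  For the probability statement, every random quantity on the explicit side, as well as \<open>g\<^sub>0\<close>,
  fluctuates on the scale \<open>1\<close>, whereas the hypothesis on \<open>\<xi>l\<close> leaves a gap of order \<open>sqrt n\<close>.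
  Chebyshev's inequality on the explicit side, carried over to the minimum by the comparison of tails,
  therefore gives probabilities tending to one (\<open>hopfield_deviation\<close>).
\<close>

section \<open>Products of standard Gaussian measures\<close>

definition std_gauss :: "real measure" where
  "std_gauss = density lborel (\<lambda>x. ennreal (std_normal_density x))"

lemma sets_std_gauss [simp, measurable_cong]: "sets std_gauss = sets borel"
  by (simp add: std_gauss_def)

lemma space_std_gauss [simp]: "space std_gauss = UNIV"
  by (simp add: std_gauss_def)

lemma prob_space_std_gauss: "prob_space std_gauss"
  unfolding std_gauss_def by (rule prob_space_normal_density) simp

interpretation std_gauss: prob_space std_gauss
  by (rule prob_space_std_gauss)

abbreviation gauss_prod :: "'k set \<Rightarrow> ('k \<Rightarrow> real) measure" where
  "gauss_prod K \<equiv> Pi\<^sub>M K (\<lambda>_. std_gauss)"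

interpretation gauss_prod: product_prob_space "\<lambda>_. std_gauss" K for K :: "'k set"
  by unfold_locales

lemma measurable_std_gauss_iff: "measurable M std_gauss = borel_measurable M"
  by (rule measurable_cong_sets) simp_all

text \<open>
  A coordinate outside \<open>K\<close> is constant on the space, hence measurable as well.
\<close>

lemma measurable_gauss_component [measurable (raw)]:
  "(\<lambda>w. w k) \<in> borel_measurable (gauss_prod K)"
proof (cases "k \<in> K")
  case True
  then have "(\<lambda>w. w k) \<in> measurable (gauss_prod K) std_gauss" by measurable
  then show ?thesis by (simp only: measurable_std_gauss_iff)
next
  case False
  then have "(\<lambda>w. w k) \<in> borel_measurable (gauss_prod K) \<longleftrightarrow>
      (\<lambda>w. undefined :: real) \<in> borel_measurable (gauss_prod K)"
    by (intro measurable_cong PiE_arb[OF _ False]) (simp add: space_PiM)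
  then show ?thesis by simp
qed

lemma measurable_shift [measurable]:
  "(\<lambda>w. \<lambda>k\<in>K. w k + t * v k) \<in> measurable (gauss_prod K) (gauss_prod K)"
  by (intro measurable_restrict, unfold measurable_std_gauss_iff, intro borel_measurable_add measurable_gauss_component borel_measurable_const)

section \<open>Translations and Gaussian integration by parts\<close>

lemma std_gauss_shift:
  "distr std_gauss borel (\<lambda>x. x + v) = density std_gauss (\<lambda>x. ennreal (exp (v * x - v\<^sup>2 / 2)))"
proof (rule measure_eqI)
  fix A assume "A \<in> sets (distr std_gauss borel (\<lambda>x. x + v))"
  then have A[measurable]: "A \<in> sets borel" by simp
  have m: "(\<lambda>x. x + v) \<in> measurable std_gauss borel" by measurable
  have "emeasure (distr std_gauss borel (\<lambda>x. x + v)) A =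
      (\<integral>\<^sup>+x. indicator A (x + v) \<partial>std_gauss)"
    using nn_integral_distr[OF m, of "indicator A"] by simp
  also have "\<dots> = (\<integral>\<^sup>+x. ennreal (std_normal_density x) * indicator A (x + v) \<partial>lborel)"
    unfolding std_gauss_def by (subst nn_integral_density) auto
  also have "\<dots> = (\<integral>\<^sup>+x. ennreal (std_normal_density (x - v)) * indicator A x \<partial>lborel)"
    using nn_integral_real_affine[of "\<lambda>x. ennreal (std_normal_density (x - v)) * indicator A x" 1 v]
    by (simp add: add.commute)
  also have "\<dots> = (\<integral>\<^sup>+x. ennreal (std_normal_density x) * (ennreal (exp (v * x - v\<^sup>2 / 2)) * indicator A x) \<partial>lborel)"
  proof (rule nn_integral_cong)
    fix x
    have "std_normal_density (x - v) = std_normal_density x * exp (v * x - v\<^sup>2 / 2)"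
    proof -
      have "- (x - v)\<^sup>2 / 2 = - x\<^sup>2 / 2 + (v * x - v\<^sup>2 / 2)" by (simp add: power2_eq_square field_simps)
      then have "exp (- (x - v)\<^sup>2 / 2) = exp (- x\<^sup>2 / 2) * exp (v * x - v\<^sup>2 / 2)"
        by (simp only: exp_add)
      then show ?thesis unfolding std_normal_density_def by simp
    qed
    then show "ennreal (std_normal_density (x - v)) * indicator A x =
        ennreal (std_normal_density x) * (ennreal (exp (v * x - v\<^sup>2 / 2)) * indicator A x)"
      by (simp add: ennreal_mult mult.assoc)
  qed
  also have "\<dots> = emeasure (density std_gauss (\<lambda>x. ennreal (exp (v * x - v\<^sup>2 / 2)))) A"
    unfolding std_gauss_def by (subst emeasure_density) (auto simp: nn_integral_density)
  finally show "emeasure (distr std_gauss borel (\<lambda>x. x + v)) A =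
      emeasure (density std_gauss (\<lambda>x. ennreal (exp (v * x - v\<^sup>2 / 2)))) A" .
qed simp

text \<open>
  Both sides are product measures whose factors are the translated Gaussians, by the one-dimensional
  formula \<open>std_gauss_shift\<close>; for the density this holds because the exponential of the sum is a product
  of functions of one coordinate each.
\<close>

lemma cameron_martin_gauss_prod:
  fixes v :: "'k \<Rightarrow> real"
  assumes K: "finite K"
  shows "distr (gauss_prod K) (gauss_prod K) (\<lambda>w. \<lambda>k\<in>K. w k + v k) =
    density (gauss_prod K) (\<lambda>w. ennreal (exp (\<Sum>k\<in>K. v k * w k - (v k)\<^sup>2 / 2)))"
proof -
  let ?N = "\<lambda>k. distr std_gauss borel (\<lambda>x. x + v k)"
  interpret N: product_prob_space ?N K
  proof (intro product_prob_spaceI)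
    show "prob_space (?N k)" for k by (intro std_gauss.prob_space_distr) simp
  qed
  have setsN: "sets (Pi\<^sub>M K ?N) = sets (gauss_prod K)" by (intro sets_PiM_cong) auto
  have 1: "distr (gauss_prod K) (gauss_prod K) (\<lambda>w. \<lambda>k\<in>K. w k + v k) = Pi\<^sub>M K ?N"
  proof (rule N.PiM_eqI[OF K])
    show "sets (distr (gauss_prod K) (gauss_prod K) (\<lambda>w. \<lambda>k\<in>K. w k + v k)) = sets (Pi\<^sub>M K ?N)"
      using setsN by simp
    fix A assume A: "\<And>k. k \<in> K \<Longrightarrow> A k \<in> sets (?N k)"
    have m: "(\<lambda>x. x + v k) -` A k \<in> sets std_gauss" if "k \<in> K" for k
      using measurable_sets[of "\<lambda>x. x + v k" borel borel "A k"] A[OF that] by simp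
    have mm: "(\<lambda>w. \<lambda>k\<in>K. w k + v k) \<in> measurable (gauss_prod K) (gauss_prod K)"
      using measurable_shift[where K = K and t = 1 and v = v] by simp
    have "emeasure (distr (gauss_prod K) (gauss_prod K) (\<lambda>w. \<lambda>k\<in>K. w k + v k)) (Pi\<^sub>E K A) =
        emeasure (gauss_prod K) ((\<lambda>w. \<lambda>k\<in>K. w k + v k) -` Pi\<^sub>E K A \<inter> space (gauss_prod K))"
      using A K by (intro emeasure_distr[OF mm]) (auto intro!: sets_PiM_I_finite)
    also have "(\<lambda>w. \<lambda>k\<in>K. w k + v k) -` Pi\<^sub>E K A \<inter> space (gauss_prod K) =
        Pi\<^sub>E K (\<lambda>k. (\<lambda>x. x + v k) -` A k)"
      by (auto simp: space_PiM PiE_iff)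
    also have "emeasure (gauss_prod K) \<dots> = (\<Prod>k\<in>K. emeasure std_gauss ((\<lambda>x. x + v k) -` A k))"
      using m by (intro gauss_prod.emeasure_PiM[OF K]) auto
    also have "\<dots> = (\<Prod>k\<in>K. emeasure (?N k) (A k))"
      using A by (intro prod.cong refl, subst emeasure_distr) auto
    finally show "emeasure (distr (gauss_prod K) (gauss_prod K) (\<lambda>w. \<lambda>k\<in>K. w k + v k)) (Pi\<^sub>E K A) =
        (\<Prod>k\<in>K. emeasure (?N k) (A k))" .
  qed
  have 2: "density (gauss_prod K) (\<lambda>w. ennreal (exp (\<Sum>k\<in>K. v k * w k - (v k)\<^sup>2 / 2))) = Pi\<^sub>M K ?N"
  proof (rule N.PiM_eqI[OF K])
    show "sets (density (gauss_prod K) (\<lambda>w. ennreal (exp (\<Sum>k\<in>K. v k * w k - (v k)\<^sup>2 / 2)))) = sets (Pi\<^sub>M K ?N)"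
      using setsN by simp
    fix A assume A: "\<And>k. k \<in> K \<Longrightarrow> A k \<in> sets (?N k)"
    have "emeasure (density (gauss_prod K) (\<lambda>w. ennreal (exp (\<Sum>k\<in>K. v k * w k - (v k)\<^sup>2 / 2)))) (Pi\<^sub>E K A)
      = (\<integral>\<^sup>+w. ennreal (exp (\<Sum>k\<in>K. v k * w k - (v k)\<^sup>2 / 2)) * indicator (Pi\<^sub>E K A) w \<partial>gauss_prod K)"
      using A K by (intro emeasure_density) (auto intro!: sets_PiM_I_finite)
    also have "\<dots> = (\<integral>\<^sup>+w. (\<Prod>k\<in>K. ennreal (exp (v k * w k - (v k)\<^sup>2 / 2)) * indicator (A k) (w k)) \<partial>gauss_prod K)"
    proof (rule nn_integral_cong)
      fix w assume "w \<in> space (gauss_prod K)"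
      then have "(indicator (Pi\<^sub>E K A) w :: ennreal) = (\<Prod>k\<in>K. indicator (A k) (w k))"
        using K by (auto simp: space_PiM PiE_iff indicator_def split: if_splits)
      then show "ennreal (exp (\<Sum>k\<in>K. v k * w k - (v k)\<^sup>2 / 2)) * indicator (Pi\<^sub>E K A) w =
          (\<Prod>k\<in>K. ennreal (exp (v k * w k - (v k)\<^sup>2 / 2)) * indicator (A k) (w k))"
        using K by (simp add: prod.distrib exp_sum prod_ennreal)
    qed
    also have "\<dots> = (\<Prod>k\<in>K. \<integral>\<^sup>+x. ennreal (exp (v k * x - (v k)\<^sup>2 / 2)) * indicator (A k) x \<partial>std_gauss)"
      using A by (intro gauss_prod.product_nn_integral_prod[OF K]) auto
    also have "\<dots> = (\<Prod>k\<in>K. emeasure (?N k) (A k))"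
      using A unfolding std_gauss_shift by (intro prod.cong refl emeasure_density[symmetric]) auto
    finally show "emeasure (density (gauss_prod K) (\<lambda>w. ennreal (exp (\<Sum>k\<in>K. v k * w k - (v k)\<^sup>2 / 2)))) (Pi\<^sub>E K A)
      = (\<Prod>k\<in>K. emeasure (?N k) (A k))" .
  qed
  from 1 2 show ?thesis by simp
qed

text \<open>
  By the mean value theorem the difference quotients inherit the bound \<open>G\<close> of the derivative, and
  dominated convergence applies.
\<close>

lemma has_derivative_lebesgue_integral:
  fixes F D :: "real \<Rightarrow> 'a \<Rightarrow> real"
  assumes e: "e > 0"
    and F: "\<And>t. \<bar>t - t0\<bar> < e \<Longrightarrow> integrable M (F t)"
    and D: "\<And>t w. \<bar>t - t0\<bar> < e \<Longrightarrow> w \<in> space M \<Longrightarrow> ((\<lambda>t. F t w) has_real_derivative D t w) (at t)"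
    and bound: "\<And>t w. \<bar>t - t0\<bar> < e \<Longrightarrow> w \<in> space M \<Longrightarrow> \<bar>D t w\<bar> \<le> G w"
    and G: "integrable M G"
    and D0: "D t0 \<in> borel_measurable M"
  shows "((\<lambda>t. \<integral>w. F t w \<partial>M) has_real_derivative (\<integral>w. D t0 w \<partial>M)) (at t0)"
proof -
  define Q where "Q t w = (F t w - F t0 w) / (t - t0)" for t w
  have "((\<lambda>t. ((\<integral>w. F t w \<partial>M) - (\<integral>w. F t0 w \<partial>M)) / (t - t0)) \<longlongrightarrow> (\<integral>w. D t0 w \<partial>M)) (at t0)"
    unfolding tendsto_at_iff_sequentially
  proof (intro allI impI)
    fix X assume X: "\<forall>i. X i \<in> UNIV - {t0}" "X \<longlonglongrightarrow> t0"
    from X(2) e have "\<forall>\<^sub>F i in sequentially. \<bar>X i - t0\<bar> < e"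
      by (auto simp: tendsto_iff dist_real_def)
    then obtain N where N: "\<And>i. i \<ge> N \<Longrightarrow> \<bar>X i - t0\<bar> < e"
      by (auto simp: eventually_sequentially)
    let ?Y = "\<lambda>i. X (i + N)"
    have Y: "\<bar>?Y i - t0\<bar> < e" "?Y i \<noteq> t0" for i using N[of "i + N"] X(1) by auto
    have Ylim: "?Y \<longlonglongrightarrow> t0" using X(2) by (rule LIMSEQ_ignore_initial_segment)
    have "(\<lambda>i. \<integral>w. Q (?Y i) w \<partial>M) \<longlonglongrightarrow> (\<integral>w. D t0 w \<partial>M)"
    proof (rule integral_dominated_convergence[where w=G])
      show "Q (?Y i) \<in> borel_measurable M" for i
        using F[OF Y(1), of i] F[of t0] e unfolding Q_def
        by (intro borel_measurable_divide borel_measurable_diff) auto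
      show "AE w in M. (\<lambda>i. Q (?Y i) w) \<longlonglongrightarrow> D t0 w"
      proof (rule AE_I2)
        fix w assume w: "w \<in> space M"
        from D[of t0 w] e w have "((\<lambda>t. Q t w) \<longlongrightarrow> D t0 w) (at t0)"
          by (simp add: has_field_derivative_iff Q_def LIM_offset_zero_iff)
        then show "(\<lambda>i. Q (?Y i) w) \<longlonglongrightarrow> D t0 w"
          unfolding tendsto_at_iff_sequentially comp_def using Y(2) Ylim by auto
      qed
      show "AE w in M. norm (Q (?Y i) w) \<le> G w" for i
      proof (rule AE_I2)
        fix w assume w: "w \<in> space M"
        have "\<bar>F (?Y i) w - F t0 w\<bar> \<le> G w * \<bar>?Y i - t0\<bar>"
        proof -
          have "norm (F (?Y i) w - F t0 w) \<le> G w * norm (?Y i - t0)"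
          proof (rule field_differentiable_bound)
            show "convex (ball t0 e)" by simp
            show "((\<lambda>t. F t w) has_field_derivative D z w) (at z within ball t0 e)" if "z \<in> ball t0 e" for z
              using that D[of z w] w by (auto simp: dist_real_def abs_minus_commute intro: has_field_derivative_at_within)
            show "norm (D z w) \<le> G w" if "z \<in> ball t0 e" for z
              using that bound[of z w] w by (auto simp: dist_real_def abs_minus_commute)
          qed (use Y(1)[of i] e in \<open>auto simp: dist_real_def abs_minus_commute\<close>)
          then show ?thesis by simp
        qed
        then show "norm (Q (?Y i) w) \<le> G w"
          using Y(2)[of i] by (simp add: Q_def abs_divide field_simps)
      qed
    qed (use G D0 in auto)
    also have "(\<lambda>i. \<integral>w. Q (?Y i) w \<partial>M) =
        (\<lambda>i. ((\<integral>w. F (?Y i) w \<partial>M) - (\<integral>w. F t0 w \<partial>M)) / (?Y i - t0))"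
      using F[OF Y(1)] F[of t0] e by (simp add: Q_def)
    finally show "((\<lambda>t. ((\<integral>w. F t w \<partial>M) - (\<integral>w. F t0 w \<partial>M)) / (t - t0)) \<circ> X) \<longlonglongrightarrow> (\<integral>w. D t0 w \<partial>M)"
      unfolding comp_def by (rule LIMSEQ_offset)
  qed
  then show ?thesis by (simp add: has_field_derivative_iff LIM_offset_zero_iff)
qed

lemma measurable_linear_gauss [measurable]:
  "(\<lambda>w. \<Sum>k\<in>K. v k * w k) \<in> borel_measurable (gauss_prod K')"
  by (intro borel_measurable_sum borel_measurable_times measurable_gauss_component) simp

lemma cameron_martin_scaled:
  fixes v :: "'k \<Rightarrow> real"
  assumes K: "finite K"
  shows "distr (gauss_prod K) (gauss_prod K) (\<lambda>w. \<lambda>k\<in>K. w k + t * v k) =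
    density (gauss_prod K) (\<lambda>w. ennreal (exp (t * (\<Sum>k\<in>K. v k * w k) - t\<^sup>2 * (\<Sum>k\<in>K. (v k)\<^sup>2) / 2)))"
proof -
  have "(\<Sum>k\<in>K. t * v k * w k - (t * v k)\<^sup>2 / 2) =
      t * (\<Sum>k\<in>K. v k * w k) - t\<^sup>2 * (\<Sum>k\<in>K. (v k)\<^sup>2) / 2" for w
    by (simp add: sum_subtractf sum_distrib_left sum_divide_distrib power_mult_distrib mult.assoc)
  with cameron_martin_gauss_prod[OF K, of "\<lambda>k. t * v k"] show ?thesis by simp
qed

text \<open>
  The Cameron-Martin density is the density of a probability measure; up to a constant factor it is
  the exponential of the linear form.
\<close>

lemma integrable_exp_linear_gauss:
  fixes v :: "'k \<Rightarrow> real"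
  assumes K: "finite K"
  shows "integrable (gauss_prod K) (\<lambda>w. exp (t * (\<Sum>k\<in>K. v k * w k)))"
proof -
  let ?V = "t\<^sup>2 * (\<Sum>k\<in>K. (v k)\<^sup>2) / 2"
  let ?g = "\<lambda>w. exp (t * (\<Sum>k\<in>K. v k * w k) - ?V)"
  have "prob_space (distr (gauss_prod K) (gauss_prod K) (\<lambda>w. \<lambda>k\<in>K. w k + t * v k))"
    by (intro gauss_prod.prob_space_distr measurable_shift)
  then interpret D: prob_space "density (gauss_prod K) (\<lambda>w. ennreal (?g w))"
    by (simp only: cameron_martin_scaled[OF K])
  have "(\<integral>\<^sup>+w. ennreal (?g w) \<partial>gauss_prod K) = emeasure (density (gauss_prod K) (\<lambda>w. ennreal (?g w))) (space (gauss_prod K))"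
    by (subst emeasure_density) (auto intro!: nn_integral_cong)
  also have "\<dots> = 1" using D.emeasure_space_1 by simp
  finally have "integrable (gauss_prod K) ?g"
    by (intro integrableI_nonneg) auto
  then have "integrable (gauss_prod K) (\<lambda>w. ?g w * exp ?V)" by (rule integrable_mult_left)
  then show ?thesis by (simp add: exp_diff)
qed

text \<open>
  The expectation of \<open>f\<close> at the translate of \<open>w\<close> by \<open>t * v\<close> can be differentiated at \<open>t = 0\<close> in two ways:
  under the integral, which gives \<open>f'\<close>, or after the translation has been moved into a
  Cameron-Martin density, whose derivative at \<open>0\<close> is the linear form.
\<close>

lemma gauss_prod_integration_by_parts:
  fixes v :: "'k \<Rightarrow> real" and f f' :: "('k \<Rightarrow> real) \<Rightarrow> real"
  assumes K: "finite K"
    and f[measurable]: "f \<in> borel_measurable (gauss_prod K)"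
    and f'[measurable]: "f' \<in> borel_measurable (gauss_prod K)"
    and B: "\<And>w. w \<in> space (gauss_prod K) \<Longrightarrow> \<bar>f w\<bar> \<le> B"
    and B': "\<And>w. w \<in> space (gauss_prod K) \<Longrightarrow> \<bar>f' w\<bar> \<le> B'"
    and deriv: "\<And>w. w \<in> space (gauss_prod K) \<Longrightarrow>
      ((\<lambda>t. f (\<lambda>k\<in>K. w k + t * v k)) has_real_derivative f' w) (at 0)"
  shows "integrable (gauss_prod K) (\<lambda>w. (\<Sum>k\<in>K. v k * w k) * f w)"
    and "(\<integral>w. (\<Sum>k\<in>K. v k * w k) * f w \<partial>gauss_prod K) = (\<integral>w. f' w \<partial>gauss_prod K)"
proof -
  let ?P = "gauss_prod K"
  define L where "L w = (\<Sum>k\<in>K. v k * w k)" for w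
  define V where "V = (\<Sum>k\<in>K. (v k)\<^sup>2)"
  define sh where "sh t w = (\<lambda>k\<in>K. w k + t * v k)" for t w
  define E where "E t w = exp (t * L w - t\<^sup>2 * V / 2)" for t w
  have L[measurable]: "L \<in> borel_measurable ?P" unfolding L_def by measurable
  have V: "V \<ge> 0" unfolding V_def by (intro sum_nonneg) auto
  have sh[measurable]: "sh t \<in> measurable ?P ?P" for t unfolding sh_def by measurable
  have space_sh: "sh t w \<in> space ?P" for t w by (auto simp: sh_def space_PiM)
  have B0: "B \<ge> 0" using B[OF space_sh[of 0 undefined]] by linarith
  have sh_sh: "sh s (sh t w) = sh (s + t) w" for s t w
    by (auto simp: sh_def algebra_simps)
  have sh_0: "sh 0 w = w" if "w \<in> space ?P" for w
    using that by (auto simp: sh_def space_PiM PiE_iff extensional_def)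
  have deriv_sh: "((\<lambda>s. f (sh s w)) has_real_derivative f' (sh t w)) (at t)" for t w
  proof -
    have "((\<lambda>s. f (sh s (sh t w))) has_real_derivative f' (sh t w)) (at 0)"
      using deriv[OF space_sh] by (simp add: sh_def)
    then show ?thesis using DERIV_shift[of "\<lambda>s. f (sh s w)" "f' (sh t w)" 0 t] by (simp add: sh_sh)
  qed
  have exp_int: "integrable ?P (\<lambda>w. exp (t * L w))" for t
    unfolding L_def by (rule integrable_exp_linear_gauss[OF K])
  have E_int: "integrable ?P (E t)" for t
    unfolding E_def exp_diff using exp_int by auto
  have fE_int: "integrable ?P (\<lambda>w. f w * E t w)" for t
  proof (rule Bochner_Integration.integrable_bound)
    show "integrable ?P (\<lambda>w. B * E t w)" using E_int by simp
    show "AE w in ?P. norm (f w * E t w) \<le> norm (B * E t w)"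
      using B B0 by (intro AE_I2) (auto simp: abs_mult E_def intro!: mult_right_mono)
  qed (use E_int[of t] in measurable)
  have shifted: "(\<integral>w. f (sh t w) \<partial>?P) = (\<integral>w. f w * E t w \<partial>?P)" for t
  proof -
    have "(\<integral>w. f (sh t w) \<partial>?P) = (\<integral>w. f w \<partial>distr ?P ?P (sh t))"
      by (rule integral_distr[symmetric]) measurable
    also have "\<dots> = (\<integral>w. f w \<partial>density ?P (\<lambda>w. ennreal (E t w)))"
      unfolding sh_def E_def L_def V_def cameron_martin_scaled[OF K] by simp
    also have "\<dots> = (\<integral>w. E t w *\<^sub>R f w \<partial>?P)"
      using E_int[of t] by (intro integral_density) (auto simp: E_def)
    finally show ?thesis by (simp add: mult.commute)
  qed
  have A: "((\<lambda>t. \<integral>w. f (sh t w) \<partial>?P) has_real_derivative (\<integral>w. f' (sh 0 w) \<partial>?P)) (at 0)"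
  proof (rule has_derivative_lebesgue_integral[where e = 1 and G = "\<lambda>_. B'"])
    show "integrable ?P (\<lambda>w. f (sh t w))" for t
      by (rule gauss_prod.integrable_const_bound[where B = B]) (auto simp: B space_sh)
  qed (use deriv_sh B' space_sh in auto)
  \<comment> \<open>For \<open>\<bar>t\<bar> < 1\<close> the derivative of the density is at most \<open>(\<bar>L\<bar> + V) exp \<bar>L\<bar>\<close>, and
      \<open>1 + \<bar>L\<bar> \<le> exp \<bar>L\<bar>\<close> turns this into the integrable bound \<open>(1 + V) exp (2 \<bar>L\<bar>)\<close>.\<close>
  have C: "((\<lambda>t. \<integral>w. f w * E t w \<partial>?P) has_real_derivative (\<integral>w. f w * (E 0 w * (L w - 0 * V)) \<partial>?P)) (at 0)"
  proof (rule has_derivative_lebesgue_integral[where e = 1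
        and G = "\<lambda>w. B * (1 + V) * (exp (2 * L w) + exp ((-2) * L w))"])
    show "integrable ?P (\<lambda>w. f w * E t w)" for t by (rule fE_int)
    show "((\<lambda>t. f w * E t w) has_real_derivative f w * (E t w * (L w - t * V))) (at t)" for t w
      unfolding E_def by (auto intro!: derivative_eq_intros simp: power2_eq_square)
    show "integrable ?P (\<lambda>w. B * (1 + V) * (exp (2 * L w) + exp ((-2) * L w)))"
      using exp_int[of 2] exp_int[of "-2"] by simp
    show "(\<lambda>w. f w * (E 0 w * (L w - 0 * V))) \<in> borel_measurable ?P"
      unfolding E_def by measurable
    fix t w assume t: "\<bar>t - 0\<bar> < (1::real)" and w: "w \<in> space ?P"
    have "E t w \<le> exp \<bar>L w\<bar>"
    proof -
      have "t * L w \<le> \<bar>t\<bar> * \<bar>L w\<bar>" by (metis abs_ge_self abs_mult)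
      also have "\<dots> \<le> 1 * \<bar>L w\<bar>" using t by (intro mult_right_mono) auto
      finally have "t * L w - t\<^sup>2 * V / 2 \<le> \<bar>L w\<bar>"
        using mult_nonneg_nonneg[OF zero_le_power2[of t] V] by linarith
      then show ?thesis by (simp add: E_def)
    qed
    moreover have "\<bar>L w - t * V\<bar> \<le> (1 + V) * exp \<bar>L w\<bar>"
    proof -
      have "\<bar>t * V\<bar> \<le> 1 * V" using t V mult_right_mono[of "\<bar>t\<bar>" 1 V] by (simp add: abs_mult)
      then have "\<bar>L w - t * V\<bar> \<le> \<bar>L w\<bar> + V" by linarith
      also have "\<dots> \<le> (1 + V) * (1 + \<bar>L w\<bar>)" using V by (simp add: algebra_simps)
      also have "\<dots> \<le> (1 + V) * exp \<bar>L w\<bar>" using V by (intro mult_left_mono) auto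
      finally show ?thesis .
    qed
    ultimately have "\<bar>E t w * (L w - t * V)\<bar> \<le> exp \<bar>L w\<bar> * ((1 + V) * exp \<bar>L w\<bar>)"
      unfolding abs_mult by (intro mult_mono) (auto simp: E_def)
    also have "\<dots> = (1 + V) * exp (2 * \<bar>L w\<bar>)" by (simp add: exp_add[symmetric])
    also have "\<dots> \<le> (1 + V) * (exp (2 * L w) + exp ((-2) * L w))"
      using V by (intro mult_left_mono) (auto simp: abs_if)
    finally have "\<bar>f w\<bar> * \<bar>E t w * (L w - t * V)\<bar> \<le> B * ((1 + V) * (exp (2 * L w) + exp ((-2) * L w)))"
      using B[OF w] B0 by (intro mult_mono) auto
    then show "\<bar>f w * (E t w * (L w - t * V))\<bar> \<le> B * (1 + V) * (exp (2 * L w) + exp ((-2) * L w))"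
      by (simp add: abs_mult mult.assoc)
  qed simp
  have "(\<integral>w. f' (sh 0 w) \<partial>?P) = (\<integral>w. f w * (E 0 w * (L w - 0 * V)) \<partial>?P)"
    using A C unfolding shifted by (rule DERIV_unique)
  moreover have "(\<integral>w. f' (sh 0 w) \<partial>?P) = (\<integral>w. f' w \<partial>?P)"
    by (rule Bochner_Integration.integral_cong) (auto simp: sh_0)
  ultimately show "(\<integral>w. (\<Sum>k\<in>K. v k * w k) * f w \<partial>?P) = (\<integral>w. f' w \<partial>?P)"
    by (simp add: E_def L_def mult.commute)
  show "integrable ?P (\<lambda>w. (\<Sum>k\<in>K. v k * w k) * f w)"
  proof (rule Bochner_Integration.integrable_bound)
    show "integrable ?P (\<lambda>w. B * (exp (1 * L w) + exp ((-1) * L w)))"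
      using exp_int[of 1] exp_int[of "-1"] by simp
    show "AE w in ?P. norm ((\<Sum>k\<in>K. v k * w k) * f w) \<le> norm (B * (exp (1 * L w) + exp ((-1) * L w)))"
    proof (rule AE_I2)
      fix w assume w: "w \<in> space ?P"
      have "\<bar>L w\<bar> \<le> exp \<bar>L w\<bar>" using exp_ge_add_one_self[of "\<bar>L w\<bar>"] by linarith
      also have "\<dots> \<le> exp (1 * L w) + exp ((-1) * L w)" by (auto simp: abs_if)
      finally have "\<bar>L w\<bar> * \<bar>f w\<bar> \<le> (exp (1 * L w) + exp ((-1) * L w)) * B"
        using B[OF w] by (intro mult_mono) auto
      then show "norm ((\<Sum>k\<in>K. v k * w k) * f w) \<le> norm (B * (exp (1 * L w) + exp ((-1) * L w)))"
        using B0 by (simp add: abs_mult L_def mult.commute)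
    qed
  qed (use L f in \<open>auto simp: L_def[abs_def]\<close>)
qed

section \<open>The interpolating process and the monotonicity of its expectation\<close>

text \<open>
  The quantity \<open>\<parallel>a\<parallel> + b\<close> for a vector \<open>a\<close> and a number \<open>b\<close>, stored as the entries below \<open>m\<close> and the entry \<open>m\<close>
  of one sequence. The parameter \<open>d\<close> removes the singularity of the norm at the origin.
\<close>

definition smooth_height :: "real \<Rightarrow> nat \<Rightarrow> (nat \<Rightarrow> real) \<Rightarrow> real" where
  "smooth_height d m a = sqrt (d\<^sup>2 + (\<Sum>i<m. (a i)\<^sup>2)) + a m"

definition smooth_height_grad :: "real \<Rightarrow> nat \<Rightarrow> (nat \<Rightarrow> real) \<Rightarrow> nat \<Rightarrow> real" where
  "smooth_height_grad d m a i = (if i < m then a i / sqrt (d\<^sup>2 + (\<Sum>i<m. (a i)\<^sup>2)) else 1)"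

lemma smooth_height_deriv:
  assumes d: "d > 0" and a: "\<And>i. i \<le> m \<Longrightarrow> ((\<lambda>t. a t i) has_real_derivative a' i) (at t)"
  shows "((\<lambda>t. smooth_height d m (a t)) has_real_derivative
    (\<Sum>i\<le>m. smooth_height_grad d m (a t) i * a' i)) (at t)"
proof -
  let ?S = "\<lambda>t. d\<^sup>2 + (\<Sum>i<m. (a t i)\<^sup>2)"
  have pos: "?S t > 0" using d by (intro add_pos_nonneg sum_nonneg) auto
  have "(?S has_real_derivative (\<Sum>i<m. 2 * a t i * a' i)) (at t)"
    using a by (auto intro!: derivative_eq_intros sum.cong simp: mult_ac)
  then have "((\<lambda>t. sqrt (?S t)) has_real_derivative (\<Sum>i<m. 2 * a t i * a' i) * (inverse (sqrt (?S t)) / 2)) (at t)"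
    using DERIV_chain2[where g = ?S, OF DERIV_real_sqrt[OF pos]] by (simp add: mult.commute)
  then have "((\<lambda>t. smooth_height d m (a t)) has_real_derivative
      (\<Sum>i<m. 2 * a t i * a' i) * (inverse (sqrt (?S t)) / 2) + a' m) (at t)"
    unfolding smooth_height_def using a by (intro DERIV_add) auto
  also have "(\<Sum>i<m. 2 * a t i * a' i) * (inverse (sqrt (?S t)) / 2) = (\<Sum>i<m. a t i / sqrt (?S t) * a' i)"
    unfolding sum_distrib_right by (intro sum.cong) (simp_all add: field_simps)
  also have "\<dots> + a' m = (\<Sum>i\<le>m. smooth_height_grad d m (a t) i * a' i)"
    by (simp add: lessThan_Suc_atMost[symmetric] smooth_height_grad_def)
  finally show ?thesis .
qed

text \<open>
  The gradient of a smoothed norm has length at most one; with equality replaced by an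
  inequality it serves as well as a unit vector in the final sign argument.
\<close>

lemma smooth_height_grad_square_sum:
  assumes "d > 0"
  shows "(\<Sum>i<m. (smooth_height_grad d m a i)\<^sup>2) \<le> 1"
proof -
  let ?S = "\<Sum>i<m. (a i)\<^sup>2"
  have S: "?S \<ge> 0" by (intro sum_nonneg) auto
  have pos: "d\<^sup>2 + ?S > 0" using S assms by (intro add_pos_nonneg) auto
  have "(\<Sum>i<m. (smooth_height_grad d m a i)\<^sup>2) = ?S / (d\<^sup>2 + ?S)"
    using pos by (simp add: smooth_height_grad_def power_divide sum_divide_distrib)
  also have "\<dots> \<le> 1" using pos by (simp add: divide_le_eq)
  finally show ?thesis .
qed

lemma smooth_height_grad_bound:
  assumes "d > 0"
  shows "\<bar>smooth_height_grad d m a i\<bar> \<le> 1"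
proof (cases "i < m")
  case True
  then have "(smooth_height_grad d m a i)\<^sup>2 \<le> (\<Sum>i<m. (smooth_height_grad d m a i)\<^sup>2)"
    by (intro member_le_sum) auto
  with smooth_height_grad_square_sum[OF assms, of m a]
  have "(smooth_height_grad d m a i)\<^sup>2 \<le> 1" by linarith
  then show ?thesis by (simp add: abs_square_le_1)
qed (simp add: smooth_height_grad_def)

lemma smooth_height_grad_inner:
  assumes "d > 0"
  shows "(\<Sum>i<m. smooth_height_grad d m a i * smooth_height_grad d m b i) \<le> 1"
proof -
  let ?u = "smooth_height_grad d m a" and ?v = "smooth_height_grad d m b"
  have "(\<Sum>i<m. ?u i * ?v i) \<le> (\<Sum>i<m. ((?u i)\<^sup>2 + (?v i)\<^sup>2) / 2)"
  proof (rule sum_mono)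
    fix i show "?u i * ?v i \<le> ((?u i)\<^sup>2 + (?v i)\<^sup>2) / 2"
      using sum_squares_bound[of "?u i" "?v i"] by simp
  qed
  also have "\<dots> = ((\<Sum>i<m. (?u i)\<^sup>2) + (\<Sum>i<m. (?v i)\<^sup>2)) / 2"
    by (simp add: sum.distrib sum_divide_distrib[symmetric])
  also have "\<dots> \<le> 1"
    using smooth_height_grad_square_sum[OF assms, of m a] smooth_height_grad_square_sum[OF assms, of m b] by simp
  finally show ?thesis .
qed

definition row_form :: "nat \<Rightarrow> (nat \<Rightarrow> nat \<Rightarrow> real) \<Rightarrow> (nat \<times> nat \<Rightarrow> real) \<Rightarrow> nat \<Rightarrow> real" where
  "row_form n c w i = (\<Sum>j\<le>n. c i j * w (i, j))"

text \<open>
  The rows \<open>i < m\<close> of the \<open>(m + 1) \<times> (n + 1)\<close> Gaussian matrix contain \<open>H\<close> followed by the entry \<open>g\<^sub>i\<close>; row \<open>m\<close>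
  contains \<open>h\<close> followed by \<open>g\<^sub>0\<close>. With these coefficients the row forms are
  \<open>sin \<theta> * (H x)\<^sub>i + cos \<theta> * g\<^sub>i\<close> and \<open>cos \<theta> * (h \<bullet> x) + sin \<theta> * g\<^sub>0\<close>. For a unit vector \<open>x\<close> each row of coefficients
  is again a unit vector.
\<close>

definition gordon_coef :: "nat \<Rightarrow> nat \<Rightarrow> real \<Rightarrow> (nat \<Rightarrow> real) \<Rightarrow> nat \<Rightarrow> nat \<Rightarrow> real" where
  "gordon_coef m n \<theta> x i j =
    (if i < m then (if j < n then sin \<theta> * x j else cos \<theta>)
     else (if j < n then cos \<theta> * x j else sin \<theta>))"

definition gordon_coef_deriv :: "nat \<Rightarrow> nat \<Rightarrow> real \<Rightarrow> (nat \<Rightarrow> real) \<Rightarrow> nat \<Rightarrow> nat \<Rightarrow> real" where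
  "gordon_coef_deriv m n \<theta> x i j =
    (if i < m then (if j < n then cos \<theta> * x j else - sin \<theta>)
     else (if j < n then - sin \<theta> * x j else cos \<theta>))"

lemma measurable_row_form [measurable]:
  "(\<lambda>w. row_form n c w i) \<in> borel_measurable (gauss_prod K)"
  unfolding row_form_def
  by (intro borel_measurable_sum borel_measurable_times measurable_gauss_component) simp

lemma row_form_gordon_coef_deriv:
  "((\<lambda>\<theta>. row_form n (gordon_coef m n \<theta> x) w i) has_real_derivative
     row_form n (gordon_coef_deriv m n \<theta> x) w i) (at \<theta>)"
proof -
  have "((\<lambda>\<theta>. gordon_coef m n \<theta> x i j) has_real_derivative gordon_coef_deriv m n \<theta> x i j) (at \<theta>)" for j
    unfolding gordon_coef_def gordon_coef_deriv_def by (auto intro!: derivative_eq_intros)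
  then show ?thesis unfolding row_form_def by (intro DERIV_sum DERIV_cmult_right)
qed

lemma gordon_coef_deriv_bound: "\<bar>gordon_coef_deriv m n \<theta> x i j\<bar> \<le> 1 + \<bar>x j\<bar>"
proof -
  have "\<bar>c * x j\<bar> \<le> 1 + \<bar>x j\<bar>" if "\<bar>c\<bar> \<le> 1" for c
    using mult_right_mono[OF that, of "\<bar>x j\<bar>"] by (simp add: abs_mult)
  moreover have "\<bar>c\<bar> \<le> 1 + \<bar>x j\<bar>" if "\<bar>c\<bar> \<le> 1" for c :: real using that by linarith
  moreover have "\<bar>sin \<theta>\<bar> \<le> 1" "\<bar>cos \<theta>\<bar> \<le> 1" "\<bar>- sin \<theta>\<bar> \<le> 1" by simp_all
  ultimately show ?thesis unfolding gordon_coef_deriv_def by presburger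
qed

text \<open>
  These are half the derivatives of the covariances between the processes at \<open>x\<close> and \<open>y\<close>. For a unit vector
  \<open>x = y\<close> they vanish, since the variances do not depend on \<open>\<theta>\<close>, and the rows of \<open>H\<close> and the last row
  contribute with opposite signs.
\<close>

lemma gordon_coef_inner:
  "(\<Sum>j\<le>n. gordon_coef_deriv m n \<theta> x i j * gordon_coef m n \<theta> y i j) =
    (if i < m then -1 else 1) * (sin \<theta> * cos \<theta> * (1 - (\<Sum>j<n. x j * y j)))"
proof -
  have "(\<Sum>j<n. cos \<theta> * x j * (sin \<theta> * y j)) = sin \<theta> * cos \<theta> * (\<Sum>j<n. x j * y j)"
    by (simp add: sum_distrib_left mult_ac)
  then show ?thesis
    by (auto simp: lessThan_Suc_atMost[symmetric] gordon_coef_def gordon_coef_deriv_def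
        sum_negf algebra_simps)
qed

lemma row_form_shift:
  assumes "i' \<le> m"
  shows "row_form n c (\<lambda>k\<in>{..m} \<times> {..n}. w k + t * (if fst k = i then b (snd k) else 0)) i' =
    row_form n c w i' + (if i' = i then t * (\<Sum>j\<le>n. b j * c i j) else 0)"
  using assms by (auto simp: row_form_def sum.distrib algebra_simps sum_distrib_left intro!: sum.cong)

lemma row_form_as_sum:
  assumes "i \<le> m"
  shows "(\<Sum>k\<in>{..m} \<times> {..n}. (if fst k = i then c i (snd k) else 0) * w k) = row_form n c w i"
proof -
  have "(\<Sum>k\<in>{..m} \<times> {..n}. (if fst k = i then c i (snd k) else 0) * w k) =
      (\<Sum>i'\<le>m. \<Sum>j\<le>n. (if i' = i then c i j else 0) * w (i', j))"
    by (simp add: sum.cartesian_product case_prod_unfold)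
  also have "\<dots> = (\<Sum>i'\<le>m. if i' = i then row_form n c w i else 0)"
    by (intro sum.cong) (auto simp: row_form_def)
  also have "\<dots> = row_form n c w i" using assms by simp
  finally show ?thesis .
qed

lemma distr_gauss_component:
  assumes "k \<in> K"
  shows "distr (gauss_prod K) borel (\<lambda>w. w k) = std_gauss"
proof -
  have "distr (gauss_prod K) borel (\<lambda>w. w k) = distr (gauss_prod K) std_gauss (\<lambda>w. w k)"
    by (rule distr_cong) simp_all
  also have "\<dots> = std_gauss" using gauss_prod.PiM_component[OF assms] .
  finally show ?thesis .
qed

lemma gauss_component_integral:
  fixes g :: "real \<Rightarrow> real"
  assumes k: "k \<in> K" and g[measurable]: "g \<in> borel_measurable borel"
  shows "integrable (gauss_prod K) (\<lambda>w. g (w k)) \<longleftrightarrow> integrable lborel (\<lambda>x. std_normal_density x * g x)"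
    and "(\<integral>w. g (w k) \<partial>gauss_prod K) = (\<integral>x. std_normal_density x * g x \<partial>lborel)"
proof -
  have m: "(\<lambda>w. w k) \<in> borel_measurable (gauss_prod K)" by (rule measurable_gauss_component)
  have "integrable (gauss_prod K) (\<lambda>w. g (w k)) \<longleftrightarrow> integrable std_gauss g"
    using integrable_distr_eq[OF m g] by (simp add: distr_gauss_component[OF k])
  also have "\<dots> \<longleftrightarrow> integrable lborel (\<lambda>x. std_normal_density x * g x)"
    unfolding std_gauss_def by (subst integrable_density) auto
  finally show "integrable (gauss_prod K) (\<lambda>w. g (w k)) \<longleftrightarrow> integrable lborel (\<lambda>x. std_normal_density x * g x)" .
  have "(\<integral>w. g (w k) \<partial>gauss_prod K) = (\<integral>x. g x \<partial>std_gauss)"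
    using integral_distr[OF m g] by (simp add: distr_gauss_component[OF k])
  also have "\<dots> = (\<integral>x. std_normal_density x * g x \<partial>lborel)"
    unfolding std_gauss_def by (subst integral_density) auto
  finally show "(\<integral>w. g (w k) \<partial>gauss_prod K) = (\<integral>x. std_normal_density x * g x \<partial>lborel)" .
qed

lemma integrable_abs_gauss_component:
  "k \<in> K \<Longrightarrow> integrable (gauss_prod K) (\<lambda>w. \<bar>w k\<bar>)"
  using gauss_component_integral(1)[of k K abs] integrable_std_normal_moment_abs[of 1] by simp

definition gordon_height ::
    "real \<Rightarrow> nat \<Rightarrow> nat \<Rightarrow> real \<Rightarrow> (nat \<Rightarrow> real) \<Rightarrow> (nat \<times> nat \<Rightarrow> real) \<Rightarrow> real" where
  "gordon_height d m n \<theta> x w = smooth_height d m (row_form n (gordon_coef m n \<theta> x) w)"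

definition gordon_grad ::
    "real \<Rightarrow> nat \<Rightarrow> nat \<Rightarrow> real \<Rightarrow> (nat \<Rightarrow> real) \<Rightarrow> (nat \<times> nat \<Rightarrow> real) \<Rightarrow> nat \<Rightarrow> real" where
  "gordon_grad d m n \<theta> x w = smooth_height_grad d m (row_form n (gordon_coef m n \<theta> x) w)"

lemma measurable_gordon_height [measurable]:
  "gordon_height d m n \<theta> x \<in> borel_measurable (gauss_prod K)"
  unfolding gordon_height_def[abs_def] smooth_height_def by measurable

lemma measurable_gordon_grad [measurable]:
  "(\<lambda>w. gordon_grad d m n \<theta> x w i) \<in> borel_measurable (gauss_prod K)"
  unfolding gordon_grad_def[abs_def] smooth_height_grad_def by measurable

lemma smooth_height_cong:
  "(\<And>i. i \<le> m \<Longrightarrow> a i = b i) \<Longrightarrow> smooth_height d m a = smooth_height d m b"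
  by (simp add: smooth_height_def)

lemma smooth_height_grad_cong:
  "(\<And>i. i \<le> m \<Longrightarrow> a i = b i) \<Longrightarrow> smooth_height_grad d m a i = smooth_height_grad d m b i"
  by (simp add: smooth_height_grad_def)

text \<open>
  The \<open>\<theta>\<close>-derivative of the product is a sum over \<open>x\<close> and over rows \<open>i\<close> of the linear form
  \<open>gordon_coef_deriv\<close> times a bounded function \<open>f\<close>. Integration by parts in the direction \<open>v x i\<close> of that form replaces
  the linear form by a derivative of \<open>f\<close>. In this direction the process at \<open>x\<close> is constant,
  because \<open>gordon_coef_inner\<close> vanishes for \<open>x = y\<close>; hence only the factors at \<open>y \<noteq> x\<close> are differentiated, and
  the derivative \<open>f'\<close> of \<open>f\<close> is made of first derivatives of \<open>\<psi>\<close> and of the norm. Summed over rows, the pair \<open>x\<close>, \<open>y\<close> contributes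
  \<open>\<psi>' \<psi>' \<Prod>\<psi>\<close> times \<open>sin \<theta> * cos \<theta> * (1 - x \<bullet> y) * (1 - u \<bullet> v)\<close>, where \<open>u\<close> and \<open>v\<close> are gradients of the smoothed norm.
\<close>

lemma gordon_interpolation_mono:
  fixes T :: "(nat \<Rightarrow> real) set" and m n :: nat and d B :: real and \<psi> \<psi>' :: "real \<Rightarrow> real"
  assumes T: "finite T" and unit: "\<And>x. x \<in> T \<Longrightarrow> (\<Sum>j<n. (x j)\<^sup>2) = 1"
    and d: "d > 0"
    and \<psi>: "\<And>s. (\<psi> has_real_derivative \<psi>' s) (at s)" "\<And>s. 0 \<le> \<psi> s" "\<And>s. \<psi> s \<le> (1::real)"
    and \<psi>': "\<And>s. 0 \<le> \<psi>' s" "\<And>s. \<psi>' s \<le> B" "\<psi>' \<in> borel_measurable borel"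
  defines "F \<equiv> \<lambda>\<theta>. \<integral>w. (\<Prod>x\<in>T. \<psi> (gordon_height d m n \<theta> x w)) \<partial>gauss_prod ({..m} \<times> {..n})"
  shows "F 0 \<le> F (pi / 2)"
proof (rule DERIV_nonneg_imp_nondecreasing[where f = F])
  let ?K = "{..m} \<times> {..n}"
  let ?P = "gauss_prod ?K"
  fix \<theta> :: real assume \<theta>: "0 \<le> \<theta>" "\<theta> \<le> pi / 2"
  note \<psi>'(3)[measurable]
  have "isCont \<psi> s" for s using \<psi>(1) by (rule DERIV_isCont)
  then have [measurable]: "\<psi> \<in> borel_measurable borel"
    by (intro borel_measurable_continuous_onI) (simp add: continuous_on_eq_continuous_at)
  have B0: "B \<ge> 0" using \<psi>'(1)[of 0] \<psi>'(2)[of 0] by linarith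
  have absB: "\<bar>\<psi>' s\<bar> \<le> B" for s using \<psi>' by simp
  have prod_bound: "\<bar>\<Prod>y\<in>A. \<psi> (g y)\<bar> \<le> 1" for A and g :: "(nat \<Rightarrow> real) \<Rightarrow> real"
  proof -
    have "(\<Prod>y\<in>A. \<psi> (g y)) \<ge> 0" using \<psi>(2) by (intro prod_nonneg) simp
    moreover have "(\<Prod>y\<in>A. \<psi> (g y)) \<le> 1" using \<psi>(2,3) by (intro prod_le_1) simp
    ultimately show ?thesis by simp
  qed
  define f where "f \<theta> x i w = \<psi>' (gordon_height d m n \<theta> x w) * gordon_grad d m n \<theta> x w i *
      (\<Prod>y\<in>T - {x}. \<psi> (gordon_height d m n \<theta> y w))" for \<theta> x i w
  define R where "R x y i = (\<Sum>j\<le>n. gordon_coef_deriv m n \<theta> x i j * gordon_coef m n \<theta> y i j)" for x y i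
  define f' where "f' x i w = \<psi>' (gordon_height d m n \<theta> x w) * gordon_grad d m n \<theta> x w i *
      (\<Sum>y\<in>T - {x}. \<psi>' (gordon_height d m n \<theta> y w) * (gordon_grad d m n \<theta> y w i * R x y i) *
        (\<Prod>z\<in>T - {x} - {y}. \<psi> (gordon_height d m n \<theta> z w)))" for x i w
  define v where "v x i k = (if fst k = i then gordon_coef_deriv m n \<theta> x i (snd k) else 0)"
    for x and i :: nat and k :: "nat \<times> nat"
  define sh where "sh x i t w = (\<lambda>k\<in>?K. w k + t * v x i k)" for x i t w
  define G where "G w = (\<Sum>x\<in>T. \<Sum>i\<le>m. \<Sum>j\<le>n. (1 + \<bar>x j\<bar>) * \<bar>w (i, j)\<bar> * B)" for w :: "nat \<times> nat \<Rightarrow> real"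
  have f_bound: "\<bar>f \<theta> x i w\<bar> \<le> B" for \<theta> x i w
  proof -
    have "\<bar>f \<theta> x i w\<bar> \<le> B * 1 * 1"
      unfolding f_def abs_mult gordon_grad_def
      using absB smooth_height_grad_bound[OF d] prod_bound B0 by (intro mult_mono) auto
    then show ?thesis by simp
  qed
  have f_meas[measurable]: "f \<theta> x i \<in> borel_measurable ?P" for \<theta> x i
    unfolding f_def by measurable
  have f'_meas[measurable]: "f' x i \<in> borel_measurable ?P" for x i
    unfolding f'_def by measurable
  have f'_bound: "\<bar>f' x i w\<bar> \<le> B * 1 * (\<Sum>y\<in>T - {x}. B * (1 * \<bar>R x y i\<bar>) * 1)" for x i w
  proof -
    have *: "\<bar>\<psi>' r * (gordon_grad d m n \<theta> y w i * c) * (\<Prod>z\<in>A. \<psi> (g z))\<bar> \<le> B * (1 * \<bar>c\<bar>) * 1"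
      for r y c A and g :: "(nat \<Rightarrow> real) \<Rightarrow> real"
      unfolding abs_mult gordon_grad_def using B0
      by (intro mult_mono absB smooth_height_grad_bound[OF d] prod_bound order_refl) auto
    have "\<bar>\<Sum>y\<in>T - {x}. \<psi>' (gordon_height d m n \<theta> y w) * (gordon_grad d m n \<theta> y w i * R x y i) *
        (\<Prod>z\<in>T - {x} - {y}. \<psi> (gordon_height d m n \<theta> z w))\<bar> \<le> (\<Sum>y\<in>T - {x}. B * (1 * \<bar>R x y i\<bar>) * 1)"
      by (rule order.trans[OF sum_abs]) (rule sum_mono[OF *])
    then show ?thesis
      unfolding f'_def abs_mult gordon_grad_def using B0
      by (intro mult_mono absB smooth_height_grad_bound[OF d]) auto
  qed

  have D: "((\<lambda>\<theta>. \<Prod>x\<in>T. \<psi> (gordon_height d m n \<theta> x w)) has_real_derivative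
      (\<Sum>x\<in>T. \<Sum>i\<le>m. row_form n (gordon_coef_deriv m n \<theta> x) w i * f \<theta> x i w)) (at \<theta>)" for \<theta> w
  proof -
    have "((\<lambda>\<theta>. \<psi> (gordon_height d m n \<theta> x w)) has_real_derivative
        \<psi>' (gordon_height d m n \<theta> x w) *
        (\<Sum>i\<le>m. gordon_grad d m n \<theta> x w i * row_form n (gordon_coef_deriv m n \<theta> x) w i)) (at \<theta>)" for x
      unfolding gordon_height_def gordon_grad_def
      by (rule DERIV_chain2[OF \<psi>(1)]) (intro smooth_height_deriv[OF d] row_form_gordon_coef_deriv)
    then have "((\<lambda>\<theta>. \<Prod>x\<in>T. \<psi> (gordon_height d m n \<theta> x w)) has_real_derivative
        (\<Sum>x\<in>T. \<psi>' (gordon_height d m n \<theta> x w) *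
          (\<Sum>i\<le>m. gordon_grad d m n \<theta> x w i * row_form n (gordon_coef_deriv m n \<theta> x) w i) *
          (\<Prod>y\<in>T - {x}. \<psi> (gordon_height d m n \<theta> y w)))) (at \<theta>)"
      by (rule has_field_derivative_prod)
    then show ?thesis by (simp add: f_def sum_distrib_left sum_distrib_right mult_ac)
  qed
  have "(F has_real_derivative
      (\<integral>w. (\<Sum>x\<in>T. \<Sum>i\<le>m. row_form n (gordon_coef_deriv m n \<theta> x) w i * f \<theta> x i w) \<partial>?P)) (at \<theta>)"
    unfolding F_def
  proof (rule has_derivative_lebesgue_integral[where e = 1 and G = G])
    show "integrable ?P (\<lambda>w. \<Prod>x\<in>T. \<psi> (gordon_height d m n \<theta> x w))" for \<theta>
      by (rule gauss_prod.integrable_const_bound[where B = 1]) (auto simp: prod_bound)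
    show "integrable ?P G"
      unfolding G_def
      by (intro Bochner_Integration.integrable_sum integrable_mult_left integrable_mult_right
          integrable_abs_gauss_component) auto
    show "\<bar>\<Sum>x\<in>T. \<Sum>i\<le>m. row_form n (gordon_coef_deriv m n \<theta> x) w i * f \<theta> x i w\<bar> \<le> G w" for \<theta> w
    proof -
      have "\<bar>row_form n (gordon_coef_deriv m n \<theta> x) w i * f \<theta> x i w\<bar> \<le>
          (\<Sum>j\<le>n. (1 + \<bar>x j\<bar>) * \<bar>w (i, j)\<bar> * B)" for x i
      proof -
        have "\<bar>row_form n (gordon_coef_deriv m n \<theta> x) w i\<bar> \<le> (\<Sum>j\<le>n. (1 + \<bar>x j\<bar>) * \<bar>w (i, j)\<bar>)"
          unfolding row_form_def
          by (intro order.trans[OF sum_abs] sum_mono)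
             (auto simp: abs_mult intro!: mult_right_mono gordon_coef_deriv_bound)
        then show ?thesis
          unfolding abs_mult sum_distrib_right[symmetric]
          using f_bound B0 by (intro mult_mono) auto
      qed
      then show ?thesis
        unfolding G_def by (intro order.trans[OF sum_abs] sum_mono)
    qed
  qed (use D in auto)
  moreover have "(\<integral>w. (\<Sum>x\<in>T. \<Sum>i\<le>m. row_form n (gordon_coef_deriv m n \<theta> x) w i * f \<theta> x i w) \<partial>?P) \<ge> 0"
  proof -
    have R_eq: "R x y i = (if i < m then -1 else 1) * (sin \<theta> * cos \<theta> * (1 - (\<Sum>j<n. x j * y j)))" for x y i
      unfolding R_def by (rule gordon_coef_inner)
    have R_self: "R x x i = 0" if "x \<in> T" for x i
      using unit[OF that] by (simp add: R_eq power2_eq_square)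
    have row_sh: "row_form n (gordon_coef m n \<theta> y) (sh x i t w) i' =
        row_form n (gordon_coef m n \<theta> y) w i' + (if i' = i then t * R x y i else 0)" if "i' \<le> m" for x y i t w i'
      unfolding sh_def v_def R_def by (rule row_form_shift[OF that])
    have parts: "integrable ?P (\<lambda>w. row_form n (gordon_coef_deriv m n \<theta> x) w i * f \<theta> x i w)"
      "(\<integral>w. row_form n (gordon_coef_deriv m n \<theta> x) w i * f \<theta> x i w \<partial>?P) = (\<integral>w. f' x i w \<partial>?P)"
      if x: "x \<in> T" and i: "i \<le> m" for x i
    proof -
      have L: "row_form n (gordon_coef_deriv m n \<theta> x) w i = (\<Sum>k\<in>?K. v x i k * w k)" for w
        unfolding v_def by (rule row_form_as_sum[OF i, symmetric])
      have der: "((\<lambda>t. f \<theta> x i (sh x i t w)) has_real_derivative f' x i w) (at 0)" if w: "w \<in> space ?P" for w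
      proof -
        have sh0: "sh x i 0 w = w"
          using w by (auto simp: sh_def space_PiM PiE_iff extensional_def)
        have "((\<lambda>t. gordon_height d m n \<theta> y (sh x i t w)) has_real_derivative
            gordon_grad d m n \<theta> y w i * R x y i) (at 0)" for y
        proof -
          have "((\<lambda>t. row_form n (gordon_coef m n \<theta> y) (sh x i t w) i') has_real_derivative
              (if i' = i then R x y i else 0)) (at 0)" if "i' \<le> m" for i'
            unfolding row_sh[OF that] by (auto intro!: derivative_eq_intros)
          from smooth_height_deriv[OF d this]
          have "((\<lambda>t. gordon_height d m n \<theta> y (sh x i t w)) has_real_derivative
            (\<Sum>i'\<le>m. gordon_grad d m n \<theta> y w i' * (if i' = i then R x y i else 0))) (at 0)"
            unfolding gordon_height_def gordon_grad_def sh0 .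
          also have "(\<Sum>i'\<le>m. gordon_grad d m n \<theta> y w i' * (if i' = i then R x y i else 0)) =
              gordon_grad d m n \<theta> y w i * R x y i"
            using i by (simp add: if_distrib[of "\<lambda>z. _ * z"] cong: if_cong)
          finally show ?thesis .
        qed
        then have "((\<lambda>t. \<psi> (gordon_height d m n \<theta> y (sh x i t w))) has_real_derivative
            \<psi>' (gordon_height d m n \<theta> y w) * (gordon_grad d m n \<theta> y w i * R x y i)) (at 0)" for y
          using DERIV_chain2[OF \<psi>(1), of "\<lambda>t. gordon_height d m n \<theta> y (sh x i t w)" _ 0 UNIV] by (simp add: sh0)
        from has_field_derivative_prod[of "T - {x}", OF this]
        have P: "((\<lambda>t. \<Prod>y\<in>T - {x}. \<psi> (gordon_height d m n \<theta> y (sh x i t w))) has_real_derivative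
            (\<Sum>y\<in>T - {x}. \<psi>' (gordon_height d m n \<theta> y w) * (gordon_grad d m n \<theta> y w i * R x y i) *
              (\<Prod>z\<in>T - {x} - {y}. \<psi> (gordon_height d m n \<theta> z w)))) (at 0)"
          by (simp add: sh0)
        \<comment> \<open>The direction is orthogonal to the coefficients of the process at \<open>x\<close> itself.\<close>
        have row_const: "row_form n (gordon_coef m n \<theta> x) (sh x i t w) i' = row_form n (gordon_coef m n \<theta> x) w i'"
          if "i' \<le> m" for t i'
          using row_sh[OF that] R_self[OF x] by simp
        have "f \<theta> x i (sh x i t w) = \<psi>' (gordon_height d m n \<theta> x w) * gordon_grad d m n \<theta> x w i *
           (\<Prod>y\<in>T - {x}. \<psi> (gordon_height d m n \<theta> y (sh x i t w)))" for t
          unfolding f_def gordon_height_def gordon_grad_def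
          by (simp add: smooth_height_cong[OF row_const] smooth_height_grad_cong[OF row_const])
        with DERIV_cmult[OF P] show ?thesis unfolding f'_def by simp
      qed
      note ibp = gauss_prod_integration_by_parts[of ?K "f \<theta> x i" "f' x i", OF _ f_meas f'_meas f_bound f'_bound
          der[unfolded sh_def]]
      show "integrable ?P (\<lambda>w. row_form n (gordon_coef_deriv m n \<theta> x) w i * f \<theta> x i w)"
        unfolding L by (rule ibp(1)) auto
      show "(\<integral>w. row_form n (gordon_coef_deriv m n \<theta> x) w i * f \<theta> x i w \<partial>?P) = (\<integral>w. f' x i w \<partial>?P)"
        unfolding L by (rule ibp(2)) auto
    qed
    have f'_int: "integrable ?P (f' x i)" for x i
      using f'_bound by (intro gauss_prod.integrable_const_bound[where B = "B * 1 * (\<Sum>y\<in>T - {x}. B * (1 * \<bar>R x y i\<bar>) * 1)"] AE_I2) auto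
    have "(\<integral>w. (\<Sum>x\<in>T. \<Sum>i\<le>m. row_form n (gordon_coef_deriv m n \<theta> x) w i * f \<theta> x i w) \<partial>?P) =
        (\<integral>w. (\<Sum>x\<in>T. \<Sum>i\<le>m. f' x i w) \<partial>?P)"
    proof -
      have "(\<integral>w. (\<Sum>x\<in>T. \<Sum>i\<le>m. row_form n (gordon_coef_deriv m n \<theta> x) w i * f \<theta> x i w) \<partial>?P) =
          (\<Sum>x\<in>T. \<integral>w. (\<Sum>i\<le>m. row_form n (gordon_coef_deriv m n \<theta> x) w i * f \<theta> x i w) \<partial>?P)"
        by (intro Bochner_Integration.integral_sum Bochner_Integration.integrable_sum parts) auto
      also have "\<dots> = (\<Sum>x\<in>T. \<Sum>i\<le>m. \<integral>w. row_form n (gordon_coef_deriv m n \<theta> x) w i * f \<theta> x i w \<partial>?P)"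
        by (intro sum.cong refl Bochner_Integration.integral_sum parts) auto
      also have "\<dots> = (\<Sum>x\<in>T. \<Sum>i\<le>m. \<integral>w. f' x i w \<partial>?P)"
        by (intro sum.cong refl parts) auto
      also have "\<dots> = (\<integral>w. (\<Sum>x\<in>T. \<Sum>i\<le>m. f' x i w) \<partial>?P)"
        using f'_int by (simp add: Bochner_Integration.integral_sum Bochner_Integration.integrable_sum)
      finally show ?thesis .
    qed
    also have "\<dots> \<ge> 0"
    proof (rule Bochner_Integration.integral_nonneg)
      fix w
      have "(\<Sum>i\<le>m. f' x i w) \<ge> 0" if x: "x \<in> T" for x
      proof -
        have "(\<Sum>i\<le>m. f' x i w) = (\<Sum>y\<in>T - {x}. \<psi>' (gordon_height d m n \<theta> x w) * \<psi>' (gordon_height d m n \<theta> y w) *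
            (\<Prod>z\<in>T - {x} - {y}. \<psi> (gordon_height d m n \<theta> z w)) *
            (\<Sum>i\<le>m. gordon_grad d m n \<theta> x w i * gordon_grad d m n \<theta> y w i * R x y i))"
          unfolding f'_def sum_distrib_left by (subst sum.swap) (simp add: mult_ac)
        also have "\<dots> \<ge> 0"
        proof (rule sum_nonneg)
          fix y assume y: "y \<in> T - {x}"
          have xy: "(\<Sum>j<n. x j * y j) \<le> 1"
          proof -
            have "(\<Sum>j<n. x j * y j) \<le> (\<Sum>j<n. ((x j)\<^sup>2 + (y j)\<^sup>2) / 2)"
            proof (rule sum_mono)
              fix j show "x j * y j \<le> ((x j)\<^sup>2 + (y j)\<^sup>2) / 2"
                using sum_squares_bound[of "x j" "y j"] by simp
            qed
            also have "\<dots> = 1" using unit[OF x] unit[of y] y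
              by (simp add: sum_divide_distrib[symmetric] sum.distrib)
            finally show ?thesis .
          qed
          define \<rho> where "\<rho> = sin \<theta> * cos \<theta> * (1 - (\<Sum>j<n. x j * y j))"
          have "\<rho> \<ge> 0" unfolding \<rho>_def using \<theta> xy
            by (intro mult_nonneg_nonneg sin_ge_zero cos_ge_zero) auto
          have "(\<Sum>i\<le>m. gordon_grad d m n \<theta> x w i * gordon_grad d m n \<theta> y w i * R x y i) =
              \<rho> * (1 - (\<Sum>i<m. gordon_grad d m n \<theta> x w i * gordon_grad d m n \<theta> y w i))"
          proof -
            have R\<rho>: "R x y i = (if i < m then - \<rho> else \<rho>)" for i by (simp add: R_eq \<rho>_def)
            have "gordon_grad d m n \<theta> x w m = 1" for x
              by (simp add: gordon_grad_def smooth_height_grad_def)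
            then have "(\<Sum>i\<le>m. gordon_grad d m n \<theta> x w i * gordon_grad d m n \<theta> y w i * R x y i) =
                (\<Sum>i<m. gordon_grad d m n \<theta> x w i * gordon_grad d m n \<theta> y w i * - \<rho>) + \<rho>"
              by (simp add: lessThan_Suc_atMost[symmetric] R\<rho>)
            then show ?thesis
              by (simp only: sum_distrib_right[symmetric]) (simp add: algebra_simps)
          qed
          also have "\<dots> \<ge> 0"
            using \<open>\<rho> \<ge> 0\<close> smooth_height_grad_inner[OF d] unfolding gordon_grad_def
            by (intro mult_nonneg_nonneg) auto
          finally show "0 \<le> \<psi>' (gordon_height d m n \<theta> x w) * \<psi>' (gordon_height d m n \<theta> y w) *
            (\<Prod>z\<in>T - {x} - {y}. \<psi> (gordon_height d m n \<theta> z w)) *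
            (\<Sum>i\<le>m. gordon_grad d m n \<theta> x w i * gordon_grad d m n \<theta> y w i * R x y i)"
            by (intro mult_nonneg_nonneg prod_nonneg \<psi>(2) \<psi>'(1))
        qed
        finally show ?thesis .
      qed
      then show "(\<Sum>x\<in>T. \<Sum>i\<le>m. f' x i w) \<ge> 0" by (rule sum_nonneg)
    qed
    finally show ?thesis .
  qed
  ultimately show "\<exists>y. (F has_real_derivative y) (at \<theta>) \<and> 0 \<le> y" by blast
qed simp

section \<open>Gordon's comparison of tails\<close>

text \<open>
  The end points of the interpolation, up to the smoothing of the norm: the process of interest at
  \<open>\<theta> = pi / 2\<close> and the decoupled one at \<open>\<theta> = 0\<close>.
\<close>

lemma gordon_height_end:
  "gordon_height d m n (pi / 2) x w =
    sqrt (d\<^sup>2 + (eucl_norm m (mat_vec n (\<lambda>i j. w (i, j)) x))\<^sup>2) + w (m, n)"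
  by (simp add: gordon_height_def smooth_height_def row_form_def gordon_coef_def eucl_norm_def
      L2_set_def mat_vec_def lessThan_Suc_atMost[symmetric] sum_nonneg mult.commute)

lemma gordon_height_start:
  "gordon_height d m n 0 x w =
    sqrt (d\<^sup>2 + (eucl_norm m (\<lambda>i. w (i, n)))\<^sup>2) + (\<Sum>j<n. x j * w (m, j))"
  by (simp add: gordon_height_def smooth_height_def row_form_def gordon_coef_def eucl_norm_def
      L2_set_def lessThan_Suc_atMost[symmetric] sum_nonneg)

lemma measurable_eucl_norm [measurable (raw)]:
  "(\<And>i. (\<lambda>w. v w i) \<in> borel_measurable M) \<Longrightarrow> (\<lambda>w. eucl_norm m (v w)) \<in> borel_measurable M"
  unfolding eucl_norm_def L2_set_def by measurable

lemma measurable_mat_vec [measurable (raw)]: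
  "(\<And>i j. (\<lambda>w. A w i j) \<in> borel_measurable M) \<Longrightarrow> (\<lambda>w. mat_vec n (A w) x i) \<in> borel_measurable M"
  unfolding mat_vec_def by (intro borel_measurable_sum borel_measurable_times borel_measurable_const) simp

lemma eucl_norm_nonneg [simp]: "eucl_norm m v \<ge> 0"
  by (simp add: eucl_norm_def L2_set_nonneg)

text \<open>
  Smooth increasing approximations, as \<open>k\<close> grows, of the indicator of \<open>{s<..}\<close>. At \<open>s\<close> itself they have the value
  \<open>1 / 2\<close>, which is why limits are only claimed off \<open>s\<close>.
\<close>

definition steep_step :: "real \<Rightarrow> nat \<Rightarrow> real \<Rightarrow> real" where
  "steep_step s k t = (1 + tanh (real (Suc k) * (t - s))) / 2"

lemma steep_step_bounds: "0 \<le> steep_step s k t" "steep_step s k t \<le> 1"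
  using tanh_real_bounds[of "real (Suc k) * (t - s)"] by (auto simp: steep_step_def)

lemma steep_step_deriv:
  "(steep_step s k has_real_derivative (real (Suc k) * (1 - (tanh (real (Suc k) * (t - s)))\<^sup>2) / 2)) (at t)"
  unfolding steep_step_def by (auto intro!: derivative_eq_intros simp: cosh_real_nonzero)

lemma steep_step_limit_one:
  assumes "h \<longlonglongrightarrow> l" "l > s"
  shows "(\<lambda>k. steep_step s k (h k)) \<longlonglongrightarrow> 1"
proof -
  have "filterlim (\<lambda>k. (h k - s) * real (Suc k)) at_top sequentially"
    using assms by (intro filterlim_tendsto_pos_mult_at_top[where c = "l - s"] tendsto_intros
        filterlim_compose[OF filterlim_real_sequentially filterlim_Suc]) auto
  from filterlim_compose[OF tanh_real_at_top this]
  have "(\<lambda>k. (1 + tanh ((h k - s) * real (Suc k))) / 2) \<longlonglongrightarrow> (1 + 1) / 2"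
    by (intro tendsto_intros) auto
  then show ?thesis by (simp add: steep_step_def mult.commute)
qed

lemma steep_step_limit_zero:
  assumes "h \<longlonglongrightarrow> l" "l < s"
  shows "(\<lambda>k. steep_step s k (h k)) \<longlonglongrightarrow> 0"
proof -
  have "(\<lambda>k. steep_step (- s) k (- h k)) \<longlonglongrightarrow> 1"
    using assms by (intro steep_step_limit_one[where l = "- l"] tendsto_intros) auto
  moreover have "steep_step s k (h k) = 1 - steep_step (- s) k (- h k)" for k
  proof -
    have "real (Suc k) * (- h k - - s) = - (real (Suc k) * (h k - s))" by (simp add: algebra_simps)
    then show ?thesis unfolding steep_step_def by (simp only: tanh_minus) (simp add: field_simps)
  qed
  ultimately show ?thesis using tendsto_diff[OF tendsto_const[of 1]] by fastforce
qed

text \<open>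
  A product of steep steps approximates the indicator of the event that the whole process exceeds \<open>s\<close>,
  and the smoothing parameter \<open>1 / (k + 1)\<close> of the norm tends to \<open>0\<close> at the same time. Since the limit is not
  determined at ties, the limit is taken on the strict event for the smaller process and on the
  complement of the weak event for the larger one; this is the reason for the two different inequality
  signs.
\<close>

lemma gordon_comparison:
  fixes T :: "(nat \<Rightarrow> real) set" and m n :: nat and s :: real
  assumes T: "finite T" and unit: "\<And>x. x \<in> T \<Longrightarrow> (\<Sum>j<n. (x j)\<^sup>2) = 1"
  defines "P \<equiv> gauss_prod ({..m} \<times> {..n})"
  shows "\<P>(w in P. \<forall>x\<in>T. s < eucl_norm m (\<lambda>i. w (i, n)) + (\<Sum>j<n. x j * w (m, j))) \<le>
    \<P>(w in P. \<forall>x\<in>T. s \<le> eucl_norm m (mat_vec n (\<lambda>i j. w (i, j)) x) + w (m, n))"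
proof -
  interpret P: prob_space P unfolding P_def by (rule prob_space_PiM) (rule prob_space_std_gauss)
  define b where "b x w = eucl_norm m (\<lambda>i. w (i, n)) + (\<Sum>j<n. x j * w (m, j))"
    for x and w :: "nat \<times> nat \<Rightarrow> real"
  define a where "a x w = eucl_norm m (mat_vec n (\<lambda>i j. w (i, j)) x) + w (m, n)"
    for x and w :: "nat \<times> nat \<Rightarrow> real"
  define EB where "EB = {w \<in> space P. \<forall>x\<in>T. s < b x w}"
  define EA where "EA = {w \<in> space P. \<forall>x\<in>T. s \<le> a x w}"
  define Q where "Q k \<theta> w = (\<Prod>x\<in>T. steep_step s k (gordon_height (inverse (real (Suc k))) m n \<theta> x w))" for k \<theta> w
  have comp [measurable]: "(\<lambda>w. w k) \<in> borel_measurable P" for k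
    unfolding P_def by (rule measurable_gauss_component)
  have [measurable]: "b x \<in> borel_measurable P" "a x \<in> borel_measurable P" for x
    unfolding a_def b_def by measurable
  have EB [measurable]: "EB \<in> sets P" and EA [measurable]: "EA \<in> sets P"
    unfolding EA_def EB_def using T by measurable
  have [measurable]: "steep_step s k \<in> borel_measurable borel" for k
    by (intro borel_measurable_continuous_onI)
       (auto simp: continuous_on_eq_continuous_at intro!: DERIV_isCont[OF steep_step_deriv])
  have [measurable]: "gordon_height d m n \<theta> x \<in> borel_measurable P" for d \<theta> x
    unfolding P_def by (rule measurable_gordon_height)
  have Q_meas [measurable]: "Q k \<theta> \<in> borel_measurable P" for k \<theta>
    unfolding Q_def by measurable
  have Q0: "0 \<le> Q k \<theta> w" for k \<theta> w
    unfolding Q_def by (intro prod_nonneg) (simp add: steep_step_bounds)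
  have Q1: "Q k \<theta> w \<le> 1" for k \<theta> w
    unfolding Q_def by (intro prod_le_1) (simp add: steep_step_bounds)
  have Q_int: "integrable P (\<lambda>w. indicator A w * Q k \<theta> w)" if "A \<in> sets P" for A k \<theta>
    using that Q0[of k \<theta>] Q1[of k \<theta>]
    by (intro P.integrable_const_bound[where B = 1] AE_I2) (auto simp: indicator_def)
  have mono: "(\<integral>w. Q k 0 w \<partial>P) \<le> (\<integral>w. Q k (pi / 2) w \<partial>P)" for k
    unfolding Q_def P_def
  proof (rule gordon_interpolation_mono[OF T unit])
    let ?\<psi>' = "\<lambda>t. real (Suc k) * (1 - (tanh (real (Suc k) * (t - s)))\<^sup>2) / 2"
    show "(steep_step s k has_real_derivative ?\<psi>' t) (at t)" for t by (rule steep_step_deriv)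
    have sq: "(tanh u)\<^sup>2 \<le> 1" for u :: real
      using tanh_real_bounds[of u] by (simp add: abs_square_le_1 abs_le_iff)
    show "0 \<le> ?\<psi>' t" for t using sq by (intro divide_nonneg_nonneg mult_nonneg_nonneg) auto
    show "?\<psi>' t \<le> real (Suc k) / 2" for t
      by (intro divide_right_mono mult_left_le) auto
    show "?\<psi>' \<in> borel_measurable borel"
      by (intro borel_measurable_continuous_onI continuous_intros) (auto simp: cosh_real_nonzero)
  qed (auto simp: steep_step_bounds)
  have smooth_lim: "(\<lambda>k. sqrt ((inverse (real (Suc k)))\<^sup>2 + c\<^sup>2) + e) \<longlonglongrightarrow> c + e" if "c \<ge> 0" for c e :: real
  proof -
    have "(\<lambda>k. sqrt ((inverse (real (Suc k)))\<^sup>2 + c\<^sup>2) + e) \<longlonglongrightarrow> sqrt (0\<^sup>2 + c\<^sup>2) + e"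
      by (intro tendsto_intros LIMSEQ_inverse_real_of_nat)
    then show ?thesis using that by simp
  qed
  have lim_b: "(\<lambda>k. gordon_height (inverse (real (Suc k))) m n 0 x w) \<longlonglongrightarrow> b x w" for x w
    unfolding gordon_height_start b_def by (rule smooth_lim) simp
  have lim_a: "(\<lambda>k. gordon_height (inverse (real (Suc k))) m n (pi / 2) x w) \<longlonglongrightarrow> a x w" for x w
    unfolding gordon_height_end a_def by (rule smooth_lim) simp
  \<comment> \<open>On \<open>EB\<close> every factor tends to \<open>1\<close>; off \<open>EA\<close> at least one factor tends to \<open>0\<close>.\<close>
  have lower: "(\<lambda>k. \<integral>w. indicator EB w * Q k 0 w \<partial>P) \<longlonglongrightarrow> (\<integral>w. indicator EB w \<partial>P)"
  proof (rule integral_dominated_convergence[where w = "\<lambda>_. 1"])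
    show "AE w in P. (\<lambda>k. indicator EB w * Q k 0 w) \<longlonglongrightarrow> indicator EB w"
    proof (rule AE_I2)
      fix w
      have "(\<lambda>k. Q k 0 w) \<longlonglongrightarrow> (\<Prod>x\<in>T. 1)" if "w \<in> EB"
        unfolding Q_def using that by (intro tendsto_prod steep_step_limit_one[OF lim_b]) (auto simp: EB_def)
      then show "(\<lambda>k. indicator EB w * Q k 0 w) \<longlonglongrightarrow> indicator EB w"
        by (cases "w \<in> EB") auto
    qed
    show "AE w in P. norm (indicator EB w * Q k 0 w) \<le> 1" for k
      using Q0 Q1 by (auto simp: indicator_def)
  qed auto
  have upper: "(\<lambda>k. \<integral>w. indicator (space P - EA) w * Q k (pi / 2) w \<partial>P) \<longlonglongrightarrow> (\<integral>w. 0 \<partial>P)"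
  proof (rule integral_dominated_convergence[where w = "\<lambda>_. 1"])
    show "AE w in P. (\<lambda>k. indicator (space P - EA) w * Q k (pi / 2) w) \<longlonglongrightarrow> 0"
    proof (rule AE_I2)
      fix w assume w: "w \<in> space P"
      have "(\<lambda>k. Q k (pi / 2) w) \<longlonglongrightarrow> 0" if "w \<notin> EA"
      proof -
        from that w obtain x where x: "x \<in> T" "a x w < s" by (auto simp: EA_def)
        have "Q k (pi / 2) w \<le> steep_step s k (gordon_height (inverse (real (Suc k))) m n (pi / 2) x w)" for k
          unfolding Q_def prod.remove[OF T x(1)]
          by (intro mult_left_le prod_le_1) (simp_all add: steep_step_bounds)
        then show ?thesis
          by (intro tendsto_sandwich[OF _ _ tendsto_const steep_step_limit_zero[OF lim_a x(2)]])
             (auto simp: Q0)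
      qed
      then show "(\<lambda>k. indicator (space P - EA) w * Q k (pi / 2) w) \<longlonglongrightarrow> 0"
        by (cases "w \<in> EA") (auto simp: w)
    qed
    show "AE w in P. norm (indicator (space P - EA) w * Q k (pi / 2) w) \<le> 1" for k
      using Q0 Q1 by (auto simp: indicator_def)
  qed auto
  have "(\<integral>w. indicator EB w * Q k 0 w \<partial>P) \<le>
      measure P EA + (\<integral>w. indicator (space P - EA) w * Q k (pi / 2) w \<partial>P)" for k
  proof -
    have "(\<integral>w. indicator EB w * Q k 0 w \<partial>P) \<le> (\<integral>w. indicator (space P) w * Q k 0 w \<partial>P)"
      using Q0 by (intro integral_mono Q_int) (auto simp: indicator_def)
    also have "\<dots> = (\<integral>w. Q k 0 w \<partial>P)"
      by (intro Bochner_Integration.integral_cong) auto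
    also have "\<dots> \<le> (\<integral>w. Q k (pi / 2) w \<partial>P)" by (rule mono)
    also have "\<dots> = (\<integral>w. indicator EA w * Q k (pi / 2) w + indicator (space P - EA) w * Q k (pi / 2) w \<partial>P)"
      by (intro Bochner_Integration.integral_cong) (auto simp: indicator_def)
    also have "\<dots> = (\<integral>w. indicator EA w * Q k (pi / 2) w \<partial>P) + (\<integral>w. indicator (space P - EA) w * Q k (pi / 2) w \<partial>P)"
      by (intro Bochner_Integration.integral_add Q_int) auto
    also have "(\<integral>w. indicator EA w * Q k (pi / 2) w \<partial>P) \<le> (\<integral>w. indicator EA w \<partial>P)"
    proof (intro integral_mono Q_int EA)
      show "integrable P (\<lambda>w. indicator EA w :: real)"
        by (intro P.integrable_const_bound[where B = 1]) auto
    qed (use Q1 in \<open>auto simp: indicator_def\<close>)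
    finally show ?thesis by simp
  qed
  from LIMSEQ_le[OF lower tendsto_add[OF tendsto_const upper]] this
  have "measure P EB \<le> measure P EA" by auto
  then show ?thesis unfolding EA_def EB_def a_def b_def .
qed

section \<open>The expected norm of a Gaussian vector\<close>

lemma gauss_prod_density:
  assumes K: "finite K"
  shows "gauss_prod K = density (Pi\<^sub>M K (\<lambda>_. lborel)) (\<lambda>w. ennreal (\<Prod>k\<in>K. std_normal_density (w k)))"
proof -
  interpret L: product_sigma_finite "\<lambda>_. lborel :: real measure" by standard
  have "density (Pi\<^sub>M K (\<lambda>_. lborel)) (\<lambda>w. ennreal (\<Prod>k\<in>K. std_normal_density (w k))) = gauss_prod K"
  proof (rule gauss_prod.PiM_eqI[OF K])
    show "sets (density (Pi\<^sub>M K (\<lambda>_. lborel)) (\<lambda>w. ennreal (\<Prod>k\<in>K. std_normal_density (w k)))) = sets (gauss_prod K)"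
      by (simp, intro sets_PiM_cong) auto
    fix A :: "'a \<Rightarrow> real set" assume "\<And>k. k \<in> K \<Longrightarrow> A k \<in> sets std_gauss"
    then have A: "A k \<in> sets borel" if "k \<in> K" for k using that by simp
    have "emeasure (density (Pi\<^sub>M K (\<lambda>_. lborel)) (\<lambda>w. ennreal (\<Prod>k\<in>K. std_normal_density (w k)))) (Pi\<^sub>E K A)
      = (\<integral>\<^sup>+w. ennreal (\<Prod>k\<in>K. std_normal_density (w k)) * indicator (Pi\<^sub>E K A) w \<partial>Pi\<^sub>M K (\<lambda>_. lborel))"
      using A K by (intro emeasure_density) (auto intro!: sets_PiM_I_finite)
    also have "\<dots> = (\<integral>\<^sup>+w. (\<Prod>k\<in>K. ennreal (std_normal_density (w k)) * indicator (A k) (w k)) \<partial>Pi\<^sub>M K (\<lambda>_. lborel))"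
    proof (rule nn_integral_cong)
      fix w assume "w \<in> space (Pi\<^sub>M K (\<lambda>_. lborel :: real measure))"
      then have "(indicator (Pi\<^sub>E K A) w :: ennreal) = (\<Prod>k\<in>K. indicator (A k) (w k))"
        using K by (auto simp: space_PiM PiE_iff indicator_def split: if_splits)
      then show "ennreal (\<Prod>k\<in>K. std_normal_density (w k)) * indicator (Pi\<^sub>E K A) w =
          (\<Prod>k\<in>K. ennreal (std_normal_density (w k)) * indicator (A k) (w k))"
        using K by (simp add: prod.distrib prod_ennreal)
    qed
    also have "\<dots> = (\<Prod>k\<in>K. \<integral>\<^sup>+x. ennreal (std_normal_density x) * indicator (A k) x \<partial>lborel)"
      using A by (intro L.product_nn_integral_prod[OF K]) auto
    also have "\<dots> = (\<Prod>k\<in>K. emeasure std_gauss (A k))"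
      using A unfolding std_gauss_def by (intro prod.cong refl emeasure_density[symmetric]) auto
    finally show "emeasure (density (Pi\<^sub>M K (\<lambda>_. lborel)) (\<lambda>w. ennreal (\<Prod>k\<in>K. std_normal_density (w k)))) (Pi\<^sub>E K A)
      = (\<Prod>k\<in>K. emeasure std_gauss (A k))" .
  qed
  then show ?thesis by simp
qed

text \<open>
  Polar coordinates: the radial part of Lebesgue measure is determined by the volumes of balls, and the
  density is the derivative of the volume with respect to the radius.
\<close>

lemma distr_L2_set_lborel:
  fixes K :: "'k set"
  assumes K: "finite K" "K \<noteq> {}"
  defines "c \<equiv> real (card K) * unit_ball_vol (real (card K))"
  shows "distr (Pi\<^sub>M K (\<lambda>_. lborel)) borel (\<lambda>w. L2_set w K) =
    density lborel (\<lambda>r. ennreal (c * r ^ (card K - 1)) * indicator {0..} r)"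
    (is "?L = ?R")
proof -
  let ?V = "unit_ball_vol (real (card K))"
  let ?M = "Pi\<^sub>M K (\<lambda>_. lborel :: real measure)"
  have m: "(\<lambda>w. L2_set w K) \<in> borel_measurable ?M"
    unfolding L2_set_def by measurable
  have card: "card K > 0" using K by (simp add: card_gt_0_iff)
  have V: "?V \<ge> 0" by simp
  have L: "emeasure ?L {..a} = emeasure ?M ({w. L2_set w K \<le> a} \<inter> space ?M)" for a
    using m by (subst emeasure_distr) (auto intro!: arg_cong[where f = "emeasure ?M"])
  have ball: "emeasure ?L {..a} = ennreal (?V * a ^ card K)" if "a > 0" for a
    unfolding L using emeasure_cball_aux[OF K(1) that] by (simp add: L2_set_def)
  have R: "emeasure ?R {..a} = ennreal (?V * a ^ card K)" if "a \<ge> 0" for a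
  proof -
    have "emeasure ?R {..a} = (\<integral>\<^sup>+r. ennreal (c * r ^ (card K - 1)) * indicator {0..a} r \<partial>lborel)"
      by (subst emeasure_density) (auto intro!: nn_integral_cong simp: indicator_def)
    also have "\<dots> = ennreal (?V * a ^ card K - ?V * 0 ^ card K)"
    proof (rule nn_integral_FTC_Icc)
      show "((\<lambda>r. ?V * r ^ card K) has_real_derivative c * r ^ (card K - 1)) (at r)" for r
        unfolding c_def by (auto intro!: derivative_eq_intros)
    qed (use that V in \<open>auto simp: c_def\<close>)
    finally show ?thesis using card by (simp add: power_0_left)
  qed
  have eq: "emeasure ?L {..a} = emeasure ?R {..a}" for a
  proof (cases "a > 0")
    case True
    then show ?thesis using ball R by simp
  next
    case False
    \<comment> \<open>The volume formula needs a positive radius, so the null set at the origin is reached as a limit.\<close>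
    have *: "emeasure ?L {..a} \<le> ennreal (?V * inverse (real (Suc n)) ^ card K)" for n
    proof -
      have "emeasure ?L {..a} \<le> emeasure ?L {..inverse (real (Suc n))}"
        using False order.trans[of a 0 "inverse (real (Suc n))"] by (intro emeasure_mono) auto
      then show ?thesis by (subst (asm) ball) auto
    qed
    have lim: "(\<lambda>n. ennreal (?V * inverse (real (Suc n)) ^ card K)) \<longlonglongrightarrow> ennreal (?V * 0 ^ card K)"
      by (intro tendsto_ennrealI tendsto_intros LIMSEQ_inverse_real_of_nat)
    have "emeasure ?L {..a} \<le> ennreal (?V * 0 ^ card K)"
      by (rule LIMSEQ_le_const[OF lim]) (use * in blast)
    then have "emeasure ?L {..a} = 0" using card by (simp add: power_0_left)
    moreover have "emeasure ?R {..a} \<le> emeasure ?R {..0}" using False by (intro emeasure_mono) auto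
    then have "emeasure ?R {..a} = 0" using card by (subst (asm) R) (auto simp: power_0_left)
    ultimately show ?thesis by simp
  qed
  show ?thesis
  proof (rule measure_eqI_generator_eq[where E = "range atMost" and \<Omega> = UNIV and A = "\<lambda>i. {..real i}"])
    show "Int_stable (range (atMost :: real \<Rightarrow> _))" by (auto simp: Int_stable_def)
    show "emeasure ?L X = emeasure ?R X" if "X \<in> range atMost" for X using that eq by auto
    have "sets (borel :: real measure) = sigma_sets UNIV (range atMost)"
      by (subst borel_eq_atMost) simp
    then show "sets ?L = sigma_sets UNIV (range atMost)" "sets ?R = sigma_sets UNIV (range atMost)" by simp_all
    show "(\<Union>i. {..real i}) = UNIV" by (auto simp: real_arch_simple)
    show "emeasure ?L {..real i} \<noteq> \<infinity>" for i unfolding eq by (subst R) auto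
  qed auto
qed

definition abs_moment :: "nat \<Rightarrow> real" where
  "abs_moment q = (\<integral>x. std_normal_density x * \<bar>x\<bar> ^ q \<partial>lborel)"

text \<open>
  The closed forms for even and odd exponents differ, but both satisfy the recursion \<open>abs_moment_rec\<close>.
\<close>

lemma abs_moment_even: "abs_moment (2 * k) = fact (2 * k) / (2 ^ k * fact k)"
  using integral_std_normal_moment_even[of k] by (simp add: abs_moment_def power_even_abs)

lemma abs_moment_odd: "abs_moment (2 * k + 1) = sqrt (2 / pi) * 2 ^ k * fact k"
  unfolding abs_moment_def by (rule integral_std_normal_moment_abs_odd)

lemma abs_moment_pos: "abs_moment q > 0"
proof (cases "even q")
  case True
  then obtain k where "q = 2 * k" by (elim evenE)
  then show ?thesis by (simp only: abs_moment_even) simp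
next
  case False
  then obtain k where "q = 2 * k + 1" by (elim oddE)
  then show ?thesis by (simp only: abs_moment_odd) simp
qed

lemma abs_moment_rec: "abs_moment (q + 2) = (real q + 1) * abs_moment q"
proof (cases "even q")
  case True
  then obtain k where q: "q = 2 * k" by (elim evenE)
  have "q + 2 = 2 * (k + 1)" using q by simp
  then show ?thesis unfolding q
  proof -
    have "(fact (2 * (k + 1)) :: real) = (2 * real k + 2) * ((2 * real k + 1) * fact (2 * k))"
      by (simp add: algebra_simps)
    then have "abs_moment (2 * (k + 1)) =
        (2 * real k + 2) * ((2 * real k + 1) * fact (2 * k)) / ((2 * real k + 2) * (2 ^ k * fact k))"
      unfolding abs_moment_even by (simp add: algebra_simps)
    also have "\<dots> = (2 * real k + 1) * abs_moment (2 * k)"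
      unfolding abs_moment_even by (subst mult_divide_mult_cancel_left) auto
    finally show "abs_moment (2 * k + 2) = (real (2 * k) + 1) * abs_moment (2 * k)" by simp
  qed
next
  case False
  then obtain k where q: "q = 2 * k + 1" by (elim oddE)
  have "q + 2 = 2 * (k + 1) + 1" using q by simp
  then show ?thesis unfolding q
    by (simp only: abs_moment_odd) (simp add: field_simps)
qed

lemma nn_integral_half_abs_moment:
  "(\<integral>\<^sup>+r. ennreal (std_normal_density r * r ^ q) * indicator {0..} r \<partial>lborel) = ennreal (abs_moment q / 2)"
proof -
  let ?f = "\<lambda>x. std_normal_density x * \<bar>x\<bar> ^ q"
  have f: "integrable lborel ?f" by (rule integrable_std_normal_moment_abs)
  have half: "integrable lborel (\<lambda>x. indicator {0..} x *\<^sub>R ?f x)"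
    using f by (intro integrable_mult_indicator) auto
  from has_bochner_integral_even_function[OF has_bochner_integral_integrable[OF half]]
  have "abs_moment q = 2 * (\<integral>x. indicator {0..} x *\<^sub>R ?f x \<partial>lborel)"
    by (simp add: abs_moment_def std_normal_density_def has_bochner_integral_iff)
  then have "abs_moment q / 2 = (\<integral>x. indicator {0..} x *\<^sub>R ?f x \<partial>lborel)" by simp
  then have "ennreal (abs_moment q / 2) = (\<integral>\<^sup>+x. ennreal (indicator {0..} x *\<^sub>R ?f x) \<partial>lborel)"
    using half by (subst nn_integral_eq_integral) auto
  also have "\<dots> = (\<integral>\<^sup>+r. ennreal (std_normal_density r * r ^ q) * indicator {0..} r \<partial>lborel)"
    by (intro nn_integral_cong) (auto simp: indicator_def)
  finally show ?thesis by simp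
qed

text \<open>
  In polar coordinates the expectation of the \<open>p\<close>-th power of the norm is a constant \<open>C\<close> times half the absolute moment of
  order \<open>card K - 1 + p\<close>. The case \<open>p = 0\<close> determines \<open>C\<close>.
\<close>

lemma gauss_norm_mean:
  fixes K :: "'k set"
  assumes K: "finite K" "K \<noteq> {}"
  shows "integrable (gauss_prod K) (\<lambda>w. L2_set w K)"
    and "(\<integral>w. L2_set w K \<partial>gauss_prod K) = abs_moment (card K) / abs_moment (card K - 1)"
proof -
  let ?m = "card K"
  let ?M = "Pi\<^sub>M K (\<lambda>_. lborel :: real measure)"
  define C where "C = real ?m * unit_ball_vol (real ?m) * (1 / sqrt (2 * pi)) ^ (?m - 1)"
  have m: "?m > 0" using K by (simp add: card_gt_0_iff)
  have C: "C \<ge> 0" unfolding C_def by simp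
  have L2[measurable]: "(\<lambda>w. L2_set w K) \<in> borel_measurable ?M"
    unfolding L2_set_def by measurable
  have dens: "(\<Prod>k\<in>K. std_normal_density (w k)) = (1 / sqrt (2 * pi)) ^ ?m * exp (- (L2_set w K)\<^sup>2 / 2)" for w
  proof -
    have "(L2_set w K)\<^sup>2 = (\<Sum>k\<in>K. (w k)\<^sup>2)" by (simp add: L2_set_def sum_nonneg)
    then have "(\<Prod>k\<in>K. exp (- (w k)\<^sup>2 / 2)) = exp (- (L2_set w K)\<^sup>2 / 2)"
      using K by (simp add: exp_sum[symmetric] sum_negf sum_divide_distrib)
    then show ?thesis
      unfolding std_normal_density_def prod.distrib by simp
  qed
  have radial: "(\<integral>\<^sup>+w. ennreal (L2_set w K ^ p) \<partial>gauss_prod K) = ennreal (C * (abs_moment (?m - 1 + p) / 2))" for p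
  proof -
    let ?g = "\<lambda>r. ennreal ((1 / sqrt (2 * pi)) ^ ?m * exp (- r\<^sup>2 / 2) * r ^ p)"
    have "(\<integral>\<^sup>+w. ennreal (L2_set w K ^ p) \<partial>gauss_prod K) =
        (\<integral>\<^sup>+w. ennreal (\<Prod>k\<in>K. std_normal_density (w k)) * ennreal (L2_set w K ^ p) \<partial>?M)"
      unfolding gauss_prod_density[OF K(1)] by (rule nn_integral_density) measurable
    also have "\<dots> = (\<integral>\<^sup>+w. ?g (L2_set w K) \<partial>?M)"
      unfolding dens by (intro nn_integral_cong) (simp add: ennreal_mult[symmetric] L2_set_nonneg)
    also have "\<dots> = (\<integral>\<^sup>+r. ?g r \<partial>distr ?M borel (\<lambda>w. L2_set w K))"
      by (subst nn_integral_distr) auto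
    also have "\<dots> = (\<integral>\<^sup>+r. ennreal (real ?m * unit_ball_vol (real ?m) * r ^ (?m - 1)) * indicator {0..} r * ?g r \<partial>lborel)"
      unfolding distr_L2_set_lborel[OF K] by (rule nn_integral_density) measurable
    also have "\<dots> = (\<integral>\<^sup>+r. ennreal C * (ennreal (std_normal_density r * r ^ (?m - 1 + p)) * indicator {0..} r) \<partial>lborel)"
    proof (rule nn_integral_cong)
      fix r :: real
      show "ennreal (real ?m * unit_ball_vol (real ?m) * r ^ (?m - 1)) * indicator {0..} r * ?g r =
          ennreal C * (ennreal (std_normal_density r * r ^ (?m - 1 + p)) * indicator {0..} r)"
      proof (cases "r \<ge> 0")
        case True
        have "(1 / sqrt (2 * pi)) ^ ?m = (1 / sqrt (2 * pi)) ^ (?m - 1) * (1 / sqrt (2 * pi))"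
          using m by (metis Suc_diff_1 power_Suc2)
        then have "real ?m * unit_ball_vol (real ?m) * r ^ (?m - 1) * ((1 / sqrt (2 * pi)) ^ ?m * exp (- r\<^sup>2 / 2) * r ^ p) =
            C * (std_normal_density r * r ^ (?m - 1 + p))"
          by (simp add: C_def std_normal_density_def power_add mult_ac)
        then show ?thesis using True C by (simp add: ennreal_mult[symmetric])
      qed simp
    qed
    also have "\<dots> = ennreal C * ennreal (abs_moment (?m - 1 + p) / 2)"
      by (subst nn_integral_cmult) (auto simp: nn_integral_half_abs_moment)
    finally show ?thesis using C abs_moment_pos[of "?m - 1 + p"] by (simp add: ennreal_mult[symmetric])
  qed
  have L2': "(\<lambda>w. L2_set w K) \<in> borel_measurable (gauss_prod K)"
    unfolding L2_set_def by measurable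
  from radial[of 0] have "C * (abs_moment (?m - 1) / 2) = 1"
    using C abs_moment_pos[of "?m - 1"] gauss_prod.emeasure_space_1[of K] by simp
  then have Cval: "C / 2 = 1 / abs_moment (?m - 1)"
    using abs_moment_pos[of "?m - 1"] by (simp add: field_simps)
  from radial[of 1] m have one: "(\<integral>\<^sup>+w. ennreal (L2_set w K) \<partial>gauss_prod K) = ennreal (C * (abs_moment ?m / 2))"
    by simp
  then show "integrable (gauss_prod K) (\<lambda>w. L2_set w K)"
    by (intro integrableI_nonneg L2') (auto simp: L2_set_nonneg)
  have "(\<integral>w. L2_set w K \<partial>gauss_prod K) = C * (abs_moment ?m / 2)"
    using one C abs_moment_pos[of ?m] by (intro integral_eq_nn_integral[THEN trans] L2') (auto simp: L2_set_nonneg)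
  also have "\<dots> = abs_moment ?m / abs_moment (?m - 1)"
    using Cval by (metis (no_types, lifting) divide_inverse mult.assoc mult.commute mult.left_neutral)
  finally show "(\<integral>w. L2_set w K \<partial>gauss_prod K) = abs_moment (card K) / abs_moment (card K - 1)" .
qed

text \<open>
  Let \<open>b k = sqrt k - 1 / (4 sqrt k)\<close>. The recursion gives \<open>r (k + 2) / r k = (k + 1) / k\<close>, while \<open>b (k + 2) / b k\<close> is
  at least as large, so \<open>r / b\<close> decreases in steps of two. The upper bound on \<open>r\<close> and the recursion
  together give \<open>r k \<ge> k / sqrt (k + 1)\<close>, so the limit of \<open>r / b\<close> along such steps is at least \<open>1\<close>, and therefore so is every term.
\<close>

lemma lower_bound_from_product_recursion:
  fixes r :: "nat \<Rightarrow> real"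
  assumes pos: "\<And>m. m \<ge> 1 \<Longrightarrow> r m > 0"
    and prod: "\<And>m. m \<ge> 1 \<Longrightarrow> r m * r (m + 1) = real m"
    and sq: "\<And>m. m \<ge> 1 \<Longrightarrow> (r m)\<^sup>2 \<le> real m"
    and m: "m \<ge> 1"
  shows "sqrt (real m) - 1 / (4 * sqrt (real m)) \<le> r m"
proof -
  define b where "b k = (4 * real k - 1) / (4 * sqrt (real k))" for k
  have b_eq: "b k = sqrt (real k) - 1 / (4 * sqrt (real k))" if "k \<ge> 1" for k
  proof -
    have "real k = sqrt (real k) * sqrt (real k)" by simp
    then show ?thesis using that by (simp add: b_def field_simps)
  qed
  have b_pos: "b k > 0" if "k \<ge> 1" for k using that by (simp add: b_def)
  have r_step: "r (k + 2) = r k * (real k + 1) / real k" if k: "k \<ge> 1" for k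
  proof -
    have 1: "r (k + 1) * r (k + 2) = real k + 1" using prod[of "k + 1"] by simp
    have 2: "r k * r (k + 1) = real k" using prod[OF k] .
    have "r (k + 2) * real k = r k * (r (k + 1) * r (k + 2))" unfolding 2[symmetric] by (simp only: mult_ac)
    then have "r (k + 2) * real k = r k * (real k + 1)" unfolding 1 .
    then show ?thesis using k by (simp add: eq_divide_eq)
  qed
  have b_sq: "(b k)\<^sup>2 = (4 * real k - 1)\<^sup>2 / (16 * real k)" for k
    by (simp add: b_def power_divide power_mult_distrib)
  have b_step: "b k * (real k + 1) / real k \<le> b (k + 2)" if k: "k \<ge> 1" for k
  proof (rule power2_le_imp_le)
    define x where "x = real k"
    have x: "x \<ge> 1" using k by (simp add: x_def)
    \<comment> \<open>After squaring and clearing denominators the two sides differ by \<open>4 * x\<^sup>2 + 11 * x - 2\<close>, which is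
        positive for \<open>x \<ge> 1\<close>.\<close>
    have "(4 * x - 1)\<^sup>2 * (x + 1)\<^sup>2 * (x + 2) + (4 * x\<^sup>2 + 11 * x - 2) = (4 * x + 7)\<^sup>2 * x ^ 3"
      by (simp add: power2_eq_square power3_eq_cube algebra_simps)
    moreover have "4 * x\<^sup>2 + 11 * x - 2 \<ge> 0"
    proof -
      have "x\<^sup>2 \<ge> 0" by simp
      then show ?thesis using x by linarith
    qed
    ultimately have "(4 * x - 1)\<^sup>2 * (x + 1)\<^sup>2 * (x + 2) \<le> (4 * x + 7)\<^sup>2 * x ^ 3" by linarith
    then have "(4 * x - 1)\<^sup>2 * (x + 1)\<^sup>2 / (16 * x ^ 3) \<le> (4 * x + 7)\<^sup>2 / (16 * (x + 2))"
      using x by (subst frac_le_eq) (auto simp: divide_le_0_iff algebra_simps)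
    moreover have "(b k * (real k + 1) / real k)\<^sup>2 = (4 * x - 1)\<^sup>2 * (x + 1)\<^sup>2 / (16 * x ^ 3)"
    proof -
      have "(b k * (real k + 1) / real k)\<^sup>2 = (b k)\<^sup>2 * (x + 1)\<^sup>2 / x\<^sup>2"
        by (simp add: power_divide power_mult_distrib x_def)
      then show ?thesis unfolding b_sq by (simp add: x_def power2_eq_square power3_eq_cube)
    qed
    moreover have "(b (k + 2))\<^sup>2 = (4 * x + 7)\<^sup>2 / (16 * (x + 2))"
    proof -
      have "4 * real (k + 2) - 1 = 4 * x + 7" "real (k + 2) = x + 2" by (simp_all add: x_def)
      then show ?thesis by (simp only: b_sq)
    qed
    ultimately show "(b k * (real k + 1) / real k)\<^sup>2 \<le> (b (k + 2))\<^sup>2" by simp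
    show "0 \<le> b (k + 2)" using b_pos[of "k + 2"] by simp
  qed
  have ratio_step: "r (k + 2) / b (k + 2) \<le> r k / b k" if k: "k \<ge> 1" for k
  proof -
    have "r (k + 2) * b k = r k * (b k * (real k + 1) / real k)"
      unfolding r_step[OF k] by (simp add: mult_ac)
    also have "\<dots> \<le> r k * b (k + 2)" using b_step[OF k] pos[OF k] by (intro mult_left_mono) auto
    finally show ?thesis using b_pos[OF k] b_pos[of "k + 2"] by (simp add: divide_le_eq pos_le_divide_eq mult_ac)
  qed
  have ratio_iter: "r (m + 2 * j) / b (m + 2 * j) \<le> r m / b m" for j
  proof (induction j)
    case (Suc j)
    have "r (m + 2 * j + 2) / b (m + 2 * j + 2) \<le> r (m + 2 * j) / b (m + 2 * j)"
      using m by (intro ratio_step) auto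
    with Suc show ?case by (simp add: add.assoc)
  qed simp
  have ratio_lower: "sqrt (real k / (real k + 1)) \<le> r k / b k" if k: "k \<ge> 1" for k
  proof -
    have "r (k + 1) \<le> sqrt (real k + 1)" using sq[of "k + 1"] by (intro real_le_rsqrt) (simp add: add.commute)
    then have "real k \<le> r k * sqrt (real k + 1)"
      using prod[OF k] pos[OF k] by (metis mult_le_cancel_left_pos)
    then have "real k / sqrt (real k + 1) \<le> r k" by (simp add: divide_le_eq)
    moreover have "b k \<le> sqrt (real k)" using b_eq[OF k] by simp
    then have "sqrt (real k / (real k + 1)) * b k \<le> sqrt (real k / (real k + 1)) * sqrt (real k)"
      by (intro mult_left_mono) auto
    moreover have "sqrt (real k / (real k + 1)) * sqrt (real k) = real k / sqrt (real k + 1)"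
      by (simp add: real_sqrt_divide)
    ultimately have "sqrt (real k / (real k + 1)) * b k \<le> r k" by linarith
    then show ?thesis using b_pos[OF k] by (simp only: pos_le_divide_eq)
  qed
  have "(\<lambda>j. sqrt (real (m + 2 * j) / (real (m + 2 * j) + 1))) \<longlonglongrightarrow> 1"
  proof -
    have "(\<lambda>k. sqrt (real k / (real k + 1))) \<longlonglongrightarrow> sqrt 1"
      using LIMSEQ_n_over_Suc_n[where 'a = real] by (intro tendsto_real_sqrt) (simp add: add.commute)
    moreover have "filterlim (\<lambda>j. m + 2 * j) sequentially sequentially"
      by (rule filterlim_subseq) (simp add: strict_mono_def)
    ultimately show ?thesis using filterlim_compose[of "\<lambda>k. sqrt (real k / (real k + 1))"] by fastforce
  qed
  moreover have "sqrt (real (m + 2 * j) / (real (m + 2 * j) + 1)) \<le> r m / b m" for j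
    using ratio_lower[of "m + 2 * j"] ratio_iter[of j] m by linarith
  ultimately have "1 \<le> r m / b m" by (intro LIMSEQ_le_const2) auto
  then show ?thesis using b_pos[OF m] b_eq[OF m] by (simp add: pos_le_divide_eq)
qed

text \<open>
  Layer-cake formula for the positive and the negative parts. The strict and weak inequalities in the
  hypothesis cause no loss, since the length of an interval does not depend on its end points.
\<close>

lemma (in prob_space) expectation_mono_of_tail_mono:
  fixes X Y :: "'a \<Rightarrow> real"
  assumes X: "integrable M X" and Y: "integrable M Y"
    and tail: "\<And>s. \<P>(w in M. s < Y w) \<le> \<P>(w in M. s \<le> X w)"
  shows "expectation Y \<le> expectation X"
proof -
  interpret pair_sigma_finite M lborel by unfold_locales
  have [measurable]: "X \<in> borel_measurable M" "Y \<in> borel_measurable M" using X Y by auto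
  have slice: "(\<integral>\<^sup>+w. indicator (A w) s \<partial>M) = indicator B s * emeasure M S"
    if "S \<in> sets M" "\<And>w. w \<in> space M \<Longrightarrow> s \<in> A w \<longleftrightarrow> s \<in> B \<and> w \<in> S" for A B S and s :: real
  proof -
    have "(\<integral>\<^sup>+w. indicator (A w) s \<partial>M) = (\<integral>\<^sup>+w. indicator B s * indicator S w \<partial>M)"
      using that(2) by (intro nn_integral_cong) (simp add: indicator_def)
    then show ?thesis using that(1) by (simp add: nn_integral_cmult_indicator)
  qed
  have len: "ennreal c = (\<integral>\<^sup>+s. indicator {0<..<c} s \<partial>lborel)"
    "ennreal c = (\<integral>\<^sup>+s. indicator {0<..c} s \<partial>lborel)"
    "ennreal (- c) = (\<integral>\<^sup>+s. indicator {c<..<0} s \<partial>lborel)"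
    "ennreal (- c) = (\<integral>\<^sup>+s. indicator {c..<0} s \<partial>lborel)" for c :: real
    by (cases "c \<ge> 0"; simp add: ennreal_neg)+
  have "(\<integral>\<^sup>+w. ennreal (Y w) \<partial>M) = (\<integral>\<^sup>+w. \<integral>\<^sup>+s. indicator {0<..<Y w} s \<partial>lborel \<partial>M)"
    by (intro nn_integral_cong) (simp only: len[symmetric])
  also have "\<dots> = (\<integral>\<^sup>+s. \<integral>\<^sup>+w. indicator {0<..<Y w} s \<partial>M \<partial>lborel)"
    by (rule Fubini'[symmetric]) (simp add: indicator_def)
  also have "\<dots> = (\<integral>\<^sup>+s. indicator {0<..} s * emeasure M {w \<in> space M. s < Y w} \<partial>lborel)"
    by (intro nn_integral_cong slice) auto
  also have "\<dots> \<le> (\<integral>\<^sup>+s. indicator {0<..} s * emeasure M {w \<in> space M. s \<le> X w} \<partial>lborel)"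
    using tail by (intro nn_integral_mono mult_left_mono) (auto simp: emeasure_eq_measure)
  also have "\<dots> = (\<integral>\<^sup>+s. \<integral>\<^sup>+w. indicator {0<..X w} s \<partial>M \<partial>lborel)"
    by (intro nn_integral_cong slice[symmetric]) auto
  also have "\<dots> = (\<integral>\<^sup>+w. \<integral>\<^sup>+s. indicator {0<..X w} s \<partial>lborel \<partial>M)"
    by (rule Fubini') (simp add: indicator_def)
  also have "\<dots> = (\<integral>\<^sup>+w. ennreal (X w) \<partial>M)"
    by (intro nn_integral_cong) (simp only: len[symmetric])
  finally have pos: "(\<integral>\<^sup>+w. ennreal (Y w) \<partial>M) \<le> (\<integral>\<^sup>+w. ennreal (X w) \<partial>M)" .
  have tail': "emeasure M {w \<in> space M. X w < s} \<le> emeasure M {w \<in> space M. Y w \<le> s}" for s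
  proof -
    have "prob {w \<in> space M. X w < s} = 1 - \<P>(w in M. s \<le> X w)"
      by (subst prob_neg[symmetric]) (auto simp: not_le)
    moreover have "prob {w \<in> space M. Y w \<le> s} = 1 - \<P>(w in M. s < Y w)"
      by (subst prob_neg[symmetric]) (auto simp: not_less)
    ultimately show ?thesis using tail[of s] by (simp add: emeasure_eq_measure)
  qed
  have "(\<integral>\<^sup>+w. ennreal (- X w) \<partial>M) = (\<integral>\<^sup>+w. \<integral>\<^sup>+s. indicator {X w<..<0} s \<partial>lborel \<partial>M)"
    by (intro nn_integral_cong) (simp only: len[symmetric])
  also have "\<dots> = (\<integral>\<^sup>+s. \<integral>\<^sup>+w. indicator {X w<..<0} s \<partial>M \<partial>lborel)"
    by (rule Fubini'[symmetric]) (simp add: indicator_def)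
  also have "\<dots> = (\<integral>\<^sup>+s. indicator {..<0} s * emeasure M {w \<in> space M. X w < s} \<partial>lborel)"
    by (intro nn_integral_cong slice) auto
  also have "\<dots> \<le> (\<integral>\<^sup>+s. indicator {..<0} s * emeasure M {w \<in> space M. Y w \<le> s} \<partial>lborel)"
    using tail' by (intro nn_integral_mono mult_left_mono) auto
  also have "\<dots> = (\<integral>\<^sup>+s. \<integral>\<^sup>+w. indicator {Y w..<0} s \<partial>M \<partial>lborel)"
    by (intro nn_integral_cong slice[symmetric]) auto
  also have "\<dots> = (\<integral>\<^sup>+w. \<integral>\<^sup>+s. indicator {Y w..<0} s \<partial>lborel \<partial>M)"
    by (rule Fubini') (simp add: indicator_def)
  also have "\<dots> = (\<integral>\<^sup>+w. ennreal (- Y w) \<partial>M)"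
    by (intro nn_integral_cong) (simp only: len[symmetric])
  finally have neg: "(\<integral>\<^sup>+w. ennreal (- X w) \<partial>M) \<le> (\<integral>\<^sup>+w. ennreal (- Y w) \<partial>M)" .
  have "enn2real (\<integral>\<^sup>+w. ennreal (Y w) \<partial>M) \<le> enn2real (\<integral>\<^sup>+w. ennreal (X w) \<partial>M)"
    using X by (intro enn2real_mono pos) (auto simp: real_integrable_def less_top)
  moreover have "enn2real (\<integral>\<^sup>+w. ennreal (- X w) \<partial>M) \<le> enn2real (\<integral>\<^sup>+w. ennreal (- Y w) \<partial>M)"
    using Y by (intro enn2real_mono neg) (auto simp: real_integrable_def less_top)
  ultimately show ?thesis
    unfolding real_lebesgue_integral_def[OF X] real_lebesgue_integral_def[OF Y] by linarith
qed

section \<open>Fluctuations of the norm and of the absolute sum\<close>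

lemma prob_space_gauss_prod: "prob_space (gauss_prod K)"
  by (rule prob_space_PiM) (rule prob_space_std_gauss)

lemma gauss_prod_total: "measure (gauss_prod K) (space (gauss_prod K)) = 1"
  by (rule prob_space.prob_space[OF prob_space_gauss_prod])

lemma integral_gauss_prod_restrict:
  fixes F :: "('k \<Rightarrow> real) \<Rightarrow> real"
  assumes K: "finite K" "J \<subseteq> K" and F: "F \<in> borel_measurable (gauss_prod J)"
    and dep: "\<And>w. F (restrict w J) = F w"
  shows "integrable (gauss_prod K) F \<longleftrightarrow> integrable (gauss_prod J) F"
    and "(\<integral>w. F w \<partial>gauss_prod K) = (\<integral>w. F w \<partial>gauss_prod J)"
proof -
  have m: "(\<lambda>w. restrict w J) \<in> measurable (gauss_prod K) (gauss_prod J)"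
    by (rule measurable_restrict_subset[OF K(2)])
  have d: "gauss_prod J = distr (gauss_prod K) (gauss_prod J) (\<lambda>w. restrict w J)"
    by (rule gauss_prod.distr_restrict[OF K(2,1)])
  show "integrable (gauss_prod K) F \<longleftrightarrow> integrable (gauss_prod J) F"
    by (subst d, subst integrable_distr_eq[OF m F]) (simp add: dep)
  show "(\<integral>w. F w \<partial>gauss_prod K) = (\<integral>w. F w \<partial>gauss_prod J)"
    by (subst d, subst integral_distr[OF m F]) (simp add: dep)
qed

lemma gauss_square_moment:
  "k \<in> K \<Longrightarrow> integrable (gauss_prod K) (\<lambda>w. (w k)\<^sup>2)"
  "k \<in> K \<Longrightarrow> (\<integral>w. (w k)\<^sup>2 \<partial>gauss_prod K) = 1"
  using gauss_component_integral[of k K "\<lambda>x. x\<^sup>2"] integrable_std_normal_moment[of 2]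
    integral_std_normal_moment_even[of 1] by simp_all

lemma gauss_abs_mean:
  "k \<in> K \<Longrightarrow> (\<integral>w. \<bar>w k\<bar> \<partial>gauss_prod K) = sqrt (2 / pi)"
  using gauss_component_integral(2)[of k K abs] integral_std_normal_moment_abs_odd[of 0] by simp

lemma gauss_mean:
  "k \<in> K \<Longrightarrow> integrable (gauss_prod K) (\<lambda>w. w k)"
  "k \<in> K \<Longrightarrow> (\<integral>w. w k \<partial>gauss_prod K) = 0"
  using gauss_component_integral[of k K "\<lambda>x. x"] integrable_std_normal_moment[of 1]
    integral_std_normal_moment_odd[of 0] by simp_all

text \<open>
  By \<open>gauss_norm_mean\<close> this is the expected norm of a standard Gaussian vector in dimension \<open>m \<ge> 1\<close>.
\<close>

definition gauss_norm_expectation :: "nat \<Rightarrow> real" where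
  "gauss_norm_expectation m = abs_moment m / abs_moment (m - 1)"

lemma gauss_norm_expectation_pos: "gauss_norm_expectation m > 0"
  by (simp add: gauss_norm_expectation_def abs_moment_pos)

lemma gauss_norm_variance:
  fixes K :: "'k set"
  assumes K: "finite K" "K \<noteq> {}"
  defines "r \<equiv> gauss_norm_expectation (card K)"
  shows "integrable (gauss_prod K) (\<lambda>w. (L2_set w K - r)\<^sup>2)"
    and "(\<integral>w. (L2_set w K - r)\<^sup>2 \<partial>gauss_prod K) = real (card K) - r\<^sup>2"
proof -
  have sq: "(L2_set w K)\<^sup>2 = (\<Sum>k\<in>K. (w k)\<^sup>2)" for w by (simp add: L2_set_def sum_nonneg)
  have int2: "integrable (gauss_prod K) (\<lambda>w. (L2_set w K)\<^sup>2)"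
    unfolding sq by (intro Bochner_Integration.integrable_sum gauss_square_moment)
  have val2: "(\<integral>w. (L2_set w K)\<^sup>2 \<partial>gauss_prod K) = real (card K)"
    unfolding sq by (subst Bochner_Integration.integral_sum) (auto simp: gauss_square_moment)
  note mean = gauss_norm_mean[OF K]
  have expand: "(L2_set w K - r)\<^sup>2 = (L2_set w K)\<^sup>2 - 2 * r * L2_set w K + r\<^sup>2" for w
    by (simp add: power2_diff)
  show "integrable (gauss_prod K) (\<lambda>w. (L2_set w K - r)\<^sup>2)"
    unfolding expand using int2 mean(1) by auto
  have "(\<integral>w. (L2_set w K - r)\<^sup>2 \<partial>gauss_prod K) = real (card K) - 2 * r * r + r\<^sup>2"
    unfolding expand using int2 mean val2 gauss_prod_total[of K]
    by (simp add: r_def gauss_norm_expectation_def)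
  then show "(\<integral>w. (L2_set w K - r)\<^sup>2 \<partial>gauss_prod K) = real (card K) - r\<^sup>2"
    by (simp add: power2_eq_square)
qed

lemma gauss_norm_expectation_square_le:
  assumes "m \<ge> 1"
  shows "(gauss_norm_expectation m)\<^sup>2 \<le> real m"
proof -
  have K: "finite {..<m}" "{..<m} \<noteq> {}" using assms by (auto simp: lessThan_empty_iff)
  have "0 \<le> (\<integral>w. (L2_set w {..<m} - gauss_norm_expectation (card {..<m}))\<^sup>2 \<partial>gauss_prod {..<m})"
    by (rule Bochner_Integration.integral_nonneg) simp
  with gauss_norm_variance(2)[OF K] show ?thesis by simp
qed

text \<open>
  Consecutive quotients telescope: the product of the expected norms in dimensions \<open>k\<close> and \<open>k + 1\<close> is
  \<open>abs_moment (k + 1) / abs_moment (k - 1) = k\<close>.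
\<close>

lemma gauss_norm_expectation_lower:
  assumes "m \<ge> 1"
  shows "sqrt (real m) - 1 / (4 * sqrt (real m)) \<le> gauss_norm_expectation m"
proof (rule lower_bound_from_product_recursion[OF _ _ _ assms])
  show "gauss_norm_expectation k * gauss_norm_expectation (k + 1) = real k" if k: "k \<ge> 1" for k
  proof -
    have "abs_moment (k + 1) = real k * abs_moment (k - 1)"
      using abs_moment_rec[of "k - 1"] k by (simp add: of_nat_diff)
    then show ?thesis
      using abs_moment_pos[of k] abs_moment_pos[of "k - 1"] by (simp add: gauss_norm_expectation_def)
  qed
qed (use gauss_norm_expectation_pos gauss_norm_expectation_square_le in auto)

text \<open>
  The lower bound on the mean is sharp enough to control the variance: its square is
  \<open>m - 1 / 2 + 1 / (16 m)\<close>.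
\<close>

lemma gauss_norm_variance_le_half:
  assumes "m \<ge> 1"
  shows "real m - (gauss_norm_expectation m)\<^sup>2 \<le> 1 / 2"
proof -
  let ?b = "sqrt (real m) - 1 / (4 * sqrt (real m))"
  have root: "sqrt (real m) \<ge> 1" using assms by simp
  then have "1 / (4 * sqrt (real m)) \<le> 1" by (subst divide_le_eq_1_pos) linarith+
  moreover note root
  ultimately have "?b \<ge> 0" by linarith
  then have "?b\<^sup>2 \<le> (gauss_norm_expectation m)\<^sup>2"
    using gauss_norm_expectation_lower[OF assms] by (intro power_mono)
  moreover have "?b\<^sup>2 = real m - 1 / 2 + 1 / (16 * real m)"
    using assms by (simp add: power2_diff power_divide power_mult_distrib)
  moreover have "1 / (16 * real m) \<ge> 0" by simp
  ultimately show ?thesis by linarith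
qed

text \<open>
  The centred terms are uncorrelated because the expectation of a product of functions of different coordinates
  factorises; each has second moment \<open>1 - 2 / pi\<close>.
\<close>

lemma gauss_abs_sum_variance:
  fixes K J :: "'k set"
  assumes K: "finite K" "J \<subseteq> K"
  defines "\<mu> \<equiv> sqrt (2 / pi)"
  shows "integrable (gauss_prod K) (\<lambda>w. (\<Sum>k\<in>J. \<bar>w k\<bar> - \<mu>)\<^sup>2)"
    and "(\<integral>w. (\<Sum>k\<in>J. \<bar>w k\<bar> - \<mu>)\<^sup>2 \<partial>gauss_prod K) \<le> real (card J)"
proof -
  let ?P = "gauss_prod K"
  let ?c = "\<lambda>x. \<bar>x\<bar> - \<mu>"
  have J: "finite J" using K finite_subset by blast
  have c_int: "integrable std_gauss ?c"
  proof -
    have "integrable std_gauss (\<lambda>x. \<bar>x\<bar>)"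
      unfolding std_gauss_def using integrable_std_normal_moment_abs[of 1] by (subst integrable_density) auto
    then show ?thesis by simp
  qed
  have c_mean: "(\<integral>x. ?c x \<partial>std_gauss) = 0"
  proof -
    have i: "integrable std_gauss (\<lambda>x. \<bar>x\<bar>)" using c_int
      by (metis (no_types, lifting) Bochner_Integration.integrable_cong diff_add_cancel
          Bochner_Integration.integrable_add std_gauss.integrable_const)
    have "(\<integral>x. \<bar>x\<bar> \<partial>std_gauss) = \<mu>"
      unfolding std_gauss_def \<mu>_def using integral_std_normal_moment_abs_odd[of 0]
      by (subst integral_density) auto
    with i show ?thesis using std_gauss.prob_space by simp
  qed
  have diag: "integrable ?P (\<lambda>w. ?c (w k) * ?c (w k))" "(\<integral>w. ?c (w k) * ?c (w k) \<partial>?P) \<le> 1"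
    if k: "k \<in> K" for k
  proof -
    have eq: "?c x * ?c x = x\<^sup>2 - 2 * \<mu> * \<bar>x\<bar> + \<mu>\<^sup>2" for x
      by (simp add: power2_eq_square algebra_simps)
    show "integrable ?P (\<lambda>w. ?c (w k) * ?c (w k))"
      unfolding eq using gauss_square_moment(1)[OF k] integrable_abs_gauss_component[OF k] by auto
    have "(\<integral>w. ?c (w k) * ?c (w k) \<partial>?P) = 1 - 2 * \<mu> * \<mu> + \<mu>\<^sup>2"
      unfolding eq using gauss_square_moment[OF k] integrable_abs_gauss_component[OF k] gauss_abs_mean[OF k]
      by (simp add: gauss_prod_total \<mu>_def)
    then show "(\<integral>w. ?c (w k) * ?c (w k) \<partial>?P) \<le> 1" by (simp add: power2_eq_square)
  qed
  have off: "integrable ?P (\<lambda>w. ?c (w j) * ?c (w k))" "(\<integral>w. ?c (w j) * ?c (w k) \<partial>?P) = 0"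
    if jk: "j \<in> K" "k \<in> K" "j \<noteq> k" for j k
  proof -
    \<comment> \<open>The product of two coordinates is written as a product over all of \<open>K\<close> with trivial factors.\<close>
    let ?f = "\<lambda>i x. if i = j \<or> i = k then ?c x else 1"
    have f_int: "integrable std_gauss (?f i)" for i using c_int by (cases "i = j \<or> i = k") auto
    have eq: "(\<Prod>i\<in>K. ?f i (w i)) = ?c (w j) * ?c (w k)" for w
    proof -
      have "(\<Prod>i\<in>K. ?f i (w i)) = (\<Prod>i\<in>{j, k}. ?f i (w i))"
        using K jk by (intro prod.mono_neutral_right) auto
      then show ?thesis using jk by simp
    qed
    show "integrable ?P (\<lambda>w. ?c (w j) * ?c (w k))"
      using gauss_prod.product_integrable_prod[where f = ?f, OF K(1) f_int] by (simp only: eq)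
    have "(\<integral>w. ?c (w j) * ?c (w k) \<partial>?P) = (\<Prod>i\<in>K. \<integral>x. ?f i x \<partial>std_gauss)"
      using gauss_prod.product_integral_prod[where f = ?f, OF K(1) f_int] by (simp only: eq)
    also have "\<dots> = 0" using K jk c_mean by (intro prod_zero bexI[of _ j]) auto
    finally show "(\<integral>w. ?c (w j) * ?c (w k) \<partial>?P) = 0" .
  qed
  have pair: "integrable ?P (\<lambda>w. ?c (w j) * ?c (w k))"
    "(\<integral>w. ?c (w j) * ?c (w k) \<partial>?P) \<le> (if j = k then 1 else 0)" if "j \<in> J" "k \<in> J" for j k
  proof -
    have "j \<in> K" "k \<in> K" using that K by auto
    then show "integrable ?P (\<lambda>w. ?c (w j) * ?c (w k))"
      "(\<integral>w. ?c (w j) * ?c (w k) \<partial>?P) \<le> (if j = k then 1 else 0)"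
      using diag off by (cases "j = k"; auto)+
  qed
  have sq: "(\<Sum>k\<in>J. ?c (w k))\<^sup>2 = (\<Sum>j\<in>J. \<Sum>k\<in>J. ?c (w j) * ?c (w k))" for w
    by (simp add: power2_eq_square sum_product)
  show "integrable ?P (\<lambda>w. (\<Sum>k\<in>J. \<bar>w k\<bar> - \<mu>)\<^sup>2)"
    unfolding sq by (intro Bochner_Integration.integrable_sum pair)
  have "(\<integral>w. (\<Sum>k\<in>J. ?c (w k))\<^sup>2 \<partial>?P) = (\<Sum>j\<in>J. \<integral>w. (\<Sum>k\<in>J. ?c (w j) * ?c (w k)) \<partial>?P)"
    unfolding sq by (intro Bochner_Integration.integral_sum Bochner_Integration.integrable_sum pair)
  also have "\<dots> = (\<Sum>j\<in>J. \<Sum>k\<in>J. \<integral>w. ?c (w j) * ?c (w k) \<partial>?P)"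
    by (intro sum.cong refl Bochner_Integration.integral_sum pair)
  also have "\<dots> \<le> (\<Sum>j\<in>J. \<Sum>k\<in>J. if j = k then 1 else 0)"
    by (intro sum_mono pair)
  also have "\<dots> = real (card J)" using J by simp
  finally show "(\<integral>w. (\<Sum>k\<in>J. \<bar>w k\<bar> - \<mu>)\<^sup>2 \<partial>?P) \<le> real (card J)" .
qed

section \<open>The minimum over the cube\<close>

definition hopfield_min :: "nat \<Rightarrow> nat \<Rightarrow> (nat \<times> nat \<Rightarrow> real) \<Rightarrow> real" where
  "hopfield_min m n w = (MIN x\<in>sign_cube n. eucl_norm m (mat_vec n (\<lambda>i j. w (i, j)) x))"

lemma finite_sign_cube: "finite (sign_cube n)"
  unfolding sign_cube_def by (intro finite_PiE) auto

lemma sign_cube_nonempty: "sign_cube n \<noteq> {}"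
  unfolding sign_cube_def by (simp add: PiE_eq_empty_iff)

lemma sign_cube_abs: "x \<in> sign_cube n \<Longrightarrow> j < n \<Longrightarrow> \<bar>x j\<bar> = 1 / sqrt (real n)"
  unfolding sign_cube_def by (auto dest!: PiE_mem[of _ _ _ j])

lemma sign_cube_unit:
  assumes "x \<in> sign_cube n" "n \<ge> 1"
  shows "(\<Sum>j<n. (x j)\<^sup>2) = 1"
proof -
  have "(x j)\<^sup>2 = 1 / real n" if "j < n" for j
  proof -
    have "(x j)\<^sup>2 = (1 / sqrt (real n))\<^sup>2" using sign_cube_abs[OF assms(1) that] by (metis power2_abs)
    then show ?thesis by (simp add: power_divide)
  qed
  then show ?thesis using assms(2) by simp
qed

lemma sign_cube_inner_ge:
  assumes "x \<in> sign_cube n"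
  shows "- (\<Sum>j<n. \<bar>h j\<bar>) / sqrt (real n) \<le> (\<Sum>j<n. x j * h j)"
proof -
  have "- (\<bar>h j\<bar> / sqrt (real n)) \<le> x j * h j" if "j < n" for j
  proof -
    have "\<bar>x j * h j\<bar> = \<bar>h j\<bar> / sqrt (real n)" by (simp add: abs_mult sign_cube_abs[OF assms that])
    then show ?thesis by linarith
  qed
  then have "(\<Sum>j<n. - (\<bar>h j\<bar> / sqrt (real n))) \<le> (\<Sum>j<n. x j * h j)" by (intro sum_mono) auto
  then show ?thesis by (simp add: sum_negf sum_divide_distrib)
qed

lemma hopfield_min_ge_iff:
  "c \<le> hopfield_min m n w \<longleftrightarrow> (\<forall>x\<in>sign_cube n. c \<le> eucl_norm m (mat_vec n (\<lambda>i j. w (i, j)) x))"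
  unfolding hopfield_min_def using finite_sign_cube sign_cube_nonempty by (subst Min_ge_iff) auto

lemma hopfield_min_nonneg: "0 \<le> hopfield_min m n w"
  by (simp add: hopfield_min_ge_iff)

text \<open>
  The minimum depends on the entries of \<open>H\<close> only, so it has the same law under the larger matrix that also carries \<open>g\<close>, \<open>h\<close> and \<open>g\<^sub>0\<close>.
\<close>

lemma hopfield_min_restrict:
  "hopfield_min m n (restrict w ({..<m} \<times> {..<n})) = hopfield_min m n w"
proof -
  have "eucl_norm m (mat_vec n (\<lambda>i j. restrict w ({..<m} \<times> {..<n}) (i, j)) x) =
      eucl_norm m (mat_vec n (\<lambda>i j. w (i, j)) x)" for x
    unfolding eucl_norm_def mat_vec_def by (intro L2_set_cong sum.cong) auto
  then show ?thesis by (simp add: hopfield_min_def)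
qed

lemma measurable_hopfield_min [measurable]: "hopfield_min m n \<in> borel_measurable (gauss_prod K)"
  unfolding hopfield_min_def[abs_def]
  by (intro borel_measurable_Min finite_sign_cube measurable_eucl_norm measurable_mat_vec measurable_gauss_component)

text \<open>
  A minimum of nonnegative functions is dominated by any one of them.
\<close>

lemma integrable_hopfield_min:
  assumes "{..<m} \<times> {..<n} \<subseteq> K"
  shows "integrable (gauss_prod K) (hopfield_min m n)"
proof -
  obtain x where x: "x \<in> sign_cube n" using sign_cube_nonempty by auto
  show ?thesis
  proof (rule Bochner_Integration.integrable_bound)
    show "integrable (gauss_prod K) (\<lambda>w. \<Sum>i<m. \<Sum>j<n. \<bar>w (i, j)\<bar> * \<bar>x j\<bar>)"
      using assms by (intro Bochner_Integration.integrable_sum integrable_mult_left integrable_abs_gauss_component) auto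
    show "AE w in gauss_prod K. norm (hopfield_min m n w) \<le> norm (\<Sum>i<m. \<Sum>j<n. \<bar>w (i, j)\<bar> * \<bar>x j\<bar>)"
    proof (rule AE_I2)
      fix w :: "nat \<times> nat \<Rightarrow> real"
      have "hopfield_min m n w \<le> eucl_norm m (mat_vec n (\<lambda>i j. w (i, j)) x)"
        using hopfield_min_ge_iff[of "hopfield_min m n w" m n w] x by auto
      also have "\<dots> \<le> (\<Sum>i<m. \<bar>mat_vec n (\<lambda>i j. w (i, j)) x i\<bar>)"
        unfolding eucl_norm_def by (rule L2_set_le_sum_abs)
      also have "\<dots> \<le> (\<Sum>i<m. \<Sum>j<n. \<bar>w (i, j)\<bar> * \<bar>x j\<bar>)"
        unfolding mat_vec_def
        by (intro sum_mono order.trans[OF sum_abs]) (simp add: abs_mult)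
      finally show "norm (hopfield_min m n w) \<le> norm (\<Sum>i<m. \<Sum>j<n. \<bar>w (i, j)\<bar> * \<bar>x j\<bar>)"
        using hopfield_min_nonneg[of m n w] by simp
    qed
  qed measurable
qed

locale gordon_pair =
  fixes m n :: nat
  assumes m: "m \<ge> 1" and n: "n \<ge> 1"
begin

abbreviation P :: "(nat \<times> nat \<Rightarrow> real) measure" where
  "P \<equiv> gauss_prod ({..m} \<times> {..n})"

text \<open>
  The minimum over the cube of the decoupled process: column \<open>n\<close> plays the role of \<open>g\<close> and row \<open>m\<close> that of \<open>h\<close>.
\<close>

definition decoupled :: "(nat \<times> nat \<Rightarrow> real) \<Rightarrow> real" where
  "decoupled w = eucl_norm m (\<lambda>i. w (i, n)) - (\<Sum>j<n. \<bar>w (m, j)\<bar>) / sqrt (real n)"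

definition decoupled_mean :: real where
  "decoupled_mean = gauss_norm_expectation m - sqrt (real n) * sqrt (2 / pi)"

lemma eucl_norm_column: "eucl_norm m (\<lambda>i. w (i, n)) = L2_set w ({..<m} \<times> {n})"
proof -
  have "(\<Sum>k\<in>{..<m} \<times> {n}. (w k)\<^sup>2) = (\<Sum>i<m. \<Sum>j\<in>{n}. (w (i, j))\<^sup>2)"
    by (simp only: sum.cartesian_product case_prod_unfold prod.collapse)
  then show ?thesis by (simp add: eucl_norm_def L2_set_def)
qed

lemma sum_last_row: "(\<Sum>j<n. f (w (m, j))) = (\<Sum>k\<in>{m} \<times> {..<n}. f (w k))"
proof -
  have "(\<Sum>k\<in>{m} \<times> {..<n}. f (w k)) = (\<Sum>i\<in>{m}. \<Sum>j<n. f (w (i, j)))"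
    by (simp only: sum.cartesian_product case_prod_unfold prod.collapse)
  then show ?thesis by simp
qed

lemma measurable_decoupled [measurable]: "decoupled \<in> borel_measurable P"
proof -
  have [measurable]: "(\<lambda>w. w k) \<in> borel_measurable P" for k by (rule measurable_gauss_component)
  show ?thesis unfolding decoupled_def[abs_def] by measurable
qed

lemma column_norm:
  defines "r \<equiv> gauss_norm_expectation m"
  shows "integrable P (\<lambda>w. eucl_norm m (\<lambda>i. w (i, n)))"
    and "integral\<^sup>L P (\<lambda>w. eucl_norm m (\<lambda>i. w (i, n))) = r"
    and "integrable P (\<lambda>w. (eucl_norm m (\<lambda>i. w (i, n)) - r)\<^sup>2)"
    and "integral\<^sup>L P (\<lambda>w. (eucl_norm m (\<lambda>i. w (i, n)) - r)\<^sup>2) \<le> 1 / 2"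
proof -
  let ?J = "{..<m} \<times> {n}"
  have J: "finite ?J" "?J \<noteq> {}" "card ?J = m" and sub: "finite ({..m} \<times> {..n})" "?J \<subseteq> {..m} \<times> {..n}"
    using m by (auto simp: lessThan_empty_iff)
  have meas: "(\<lambda>w. L2_set w ?J) \<in> borel_measurable (gauss_prod ?J)"
    unfolding L2_set_def by measurable
  have dep: "L2_set (restrict w ?J) ?J = L2_set w ?J" for w :: "nat \<times> nat \<Rightarrow> real"
    by (rule L2_set_cong) auto
  note transfer = integral_gauss_prod_restrict[OF sub]
  show "integrable P (\<lambda>w. eucl_norm m (\<lambda>i. w (i, n)))"
    unfolding eucl_norm_column using transfer(1)[OF meas dep] gauss_norm_mean(1)[OF J(1,2)] by simp
  show "integral\<^sup>L P (\<lambda>w. eucl_norm m (\<lambda>i. w (i, n))) = r"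
    unfolding eucl_norm_column
    using transfer(2)[OF meas dep] gauss_norm_mean(2)[OF J(1,2)] J(3) by (simp add: r_def gauss_norm_expectation_def)
  have meas2: "(\<lambda>w. (L2_set w ?J - r)\<^sup>2) \<in> borel_measurable (gauss_prod ?J)"
    using meas by simp
  have dep2: "(L2_set (restrict w ?J) ?J - r)\<^sup>2 = (L2_set w ?J - r)\<^sup>2" for w :: "nat \<times> nat \<Rightarrow> real"
    unfolding dep ..
  note var = gauss_norm_variance[OF J(1,2), unfolded J(3), folded r_def]
  show "integrable P (\<lambda>w. (eucl_norm m (\<lambda>i. w (i, n)) - r)\<^sup>2)"
    unfolding eucl_norm_column using transfer(1)[OF meas2 dep2] var(1) by simp
  show "integral\<^sup>L P (\<lambda>w. (eucl_norm m (\<lambda>i. w (i, n)) - r)\<^sup>2) \<le> 1 / 2"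
    unfolding eucl_norm_column using transfer(2)[OF meas2 dep2] var(2) gauss_norm_variance_le_half[OF m]
    by (simp add: r_def)
qed

lemma decoupled_expectation:
  "integrable P decoupled" "integral\<^sup>L P decoupled = decoupled_mean"
proof -
  have row: "integrable P (\<lambda>w. \<bar>w (m, j)\<bar>)" "integral\<^sup>L P (\<lambda>w. \<bar>w (m, j)\<bar>) = sqrt (2 / pi)" if "j < n" for j
    using that by (auto intro!: integrable_abs_gauss_component gauss_abs_mean)
  have int: "integrable P (\<lambda>w. \<Sum>j<n. \<bar>w (m, j)\<bar>)"
    using row by (intro Bochner_Integration.integrable_sum) auto
  have "integral\<^sup>L P (\<lambda>w. \<Sum>j<n. \<bar>w (m, j)\<bar>) = real n * sqrt (2 / pi)"
    using row by (subst Bochner_Integration.integral_sum) auto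
  moreover have "real n / sqrt (real n) = sqrt (real n)" by (simp add: real_div_sqrt)
  ultimately have val: "integral\<^sup>L P (\<lambda>w. \<Sum>j<n. \<bar>w (m, j)\<bar>) / sqrt (real n) = sqrt (real n) * sqrt (2 / pi)"
    by (metis times_divide_eq_left)
  show "integrable P decoupled"
    unfolding decoupled_def[abs_def] using column_norm(1) int by auto
  show "integral\<^sup>L P decoupled = decoupled_mean"
    unfolding decoupled_def[abs_def] decoupled_mean_def val[symmetric] using column_norm(1,2) int by simp
qed

text \<open>
  The deviation is the sum of the deviations of the norm and of the scaled absolute sum, whose
  second moments are at most \<open>1 / 2\<close> and \<open>1\<close>. The crude bound \<open>(b - a)\<^sup>2 \<le> 2 a\<^sup>2 + 2 b\<^sup>2\<close> gives the constant \<open>3\<close>.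
\<close>

lemma decoupled_deviation:
  assumes t: "t > 0"
  shows "measure P {w \<in> space P. decoupled w \<le> decoupled_mean - t} \<le> 3 / t\<^sup>2"
proof -
  let ?\<mu> = "sqrt (2 / pi)"
  define U where "U w = (eucl_norm m (\<lambda>i. w (i, n)) - gauss_norm_expectation m)\<^sup>2" for w :: "nat \<times> nat \<Rightarrow> real"
  define V where "V w = (\<Sum>k\<in>{m} \<times> {..<n}. \<bar>w k\<bar> - ?\<mu>)\<^sup>2" for w :: "nat \<times> nat \<Rightarrow> real"
  have sub: "finite ({..m} \<times> {..n})" "{m} \<times> {..<n} \<subseteq> {..m} \<times> {..n}" by auto
  have U: "integrable P U" "integral\<^sup>L P U \<le> 1 / 2" unfolding U_def using column_norm(3,4) by auto
  have V: "integrable P V" "integral\<^sup>L P V \<le> real n"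
    unfolding V_def using gauss_abs_sum_variance[OF sub] by auto
  have W: "integrable P (\<lambda>w. 2 * U w + 2 * V w / real n)" using U V by auto
  have bound: "t\<^sup>2 \<le> 2 * U w + 2 * V w / real n" if "decoupled w \<le> decoupled_mean - t" for w
  proof -
    define a where "a = eucl_norm m (\<lambda>i. w (i, n)) - gauss_norm_expectation m"
    define b where "b = (\<Sum>j<n. \<bar>w (m, j)\<bar> - ?\<mu>) / sqrt (real n)"
    have "real n / sqrt (real n) = sqrt (real n)" by (simp add: real_div_sqrt)
    then have "b = (\<Sum>j<n. \<bar>w (m, j)\<bar>) / sqrt (real n) - sqrt (real n) * ?\<mu>"
      unfolding b_def by (simp add: sum_subtractf diff_divide_distrib) (metis times_divide_eq_left)
    then have "t \<le> b - a" using that by (simp add: decoupled_def decoupled_mean_def a_def)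
    then have "t\<^sup>2 \<le> (b - a)\<^sup>2" using t by (intro power_mono) auto
    also have "\<dots> \<le> 2 * a\<^sup>2 + 2 * b\<^sup>2"
      using zero_le_power2[of "a + b"] by (simp add: power2_eq_square algebra_simps)
    also have "b\<^sup>2 = V w / real n"
      unfolding b_def V_def sum_last_row[of "\<lambda>x. \<bar>x\<bar> - ?\<mu>"] by (simp add: power_divide)
    finally show ?thesis by (simp add: U_def a_def)
  qed
  have "measure P {w \<in> space P. decoupled w \<le> decoupled_mean - t} \<le>
      measure P {w \<in> space P. t\<^sup>2 \<le> 2 * U w + 2 * V w / real n}"
    using bound U V by (intro gauss_prod.P.finite_measure_mono) auto
  also have "\<dots> \<le> integral\<^sup>L P (\<lambda>w. 2 * U w + 2 * V w / real n) / t\<^sup>2"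
    by (rule integral_Markov_inequality_measure[OF W, where A = "{}"]) (use t in \<open>auto simp: U_def V_def\<close>)
  also have "\<dots> \<le> 3 / t\<^sup>2"
  proof (rule divide_right_mono)
    have "integral\<^sup>L P (\<lambda>w. 2 * U w + 2 * V w / real n) = 2 * integral\<^sup>L P U + 2 * integral\<^sup>L P V / real n"
      using U V by simp
    also have "\<dots> \<le> 2 * (1 / 2) + 2 * real n / real n"
      using U V n by (intro add_mono divide_right_mono mult_left_mono) auto
    finally show "integral\<^sup>L P (\<lambda>w. 2 * U w + 2 * V w / real n) \<le> 3" using n by simp
  qed simp
  finally show ?thesis .
qed

lemma hopfield_tail_comparison:
  "measure P {w \<in> space P. s < decoupled w} \<le> measure P {w \<in> space P. s \<le> hopfield_min m n w + w (m, n)}"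
proof -
  have [measurable]: "(\<lambda>w. w k) \<in> borel_measurable P" for k by (rule measurable_gauss_component)
  have "measure P {w \<in> space P. s < decoupled w} \<le>
      measure P {w \<in> space P. \<forall>x\<in>sign_cube n. s < eucl_norm m (\<lambda>i. w (i, n)) + (\<Sum>j<n. x j * w (m, j))}"
  proof (rule gauss_prod.P.finite_measure_mono)
    show "{w \<in> space P. s < decoupled w} \<subseteq>
        {w \<in> space P. \<forall>x\<in>sign_cube n. s < eucl_norm m (\<lambda>i. w (i, n)) + (\<Sum>j<n. x j * w (m, j))}"
    proof safe
      fix w x assume "s < decoupled w" "x \<in> sign_cube n"
      then show "s < eucl_norm m (\<lambda>i. w (i, n)) + (\<Sum>j<n. x j * w (m, j))"
        using sign_cube_inner_ge[of x n "\<lambda>j. w (m, j)"] by (simp add: decoupled_def)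
    qed
    show "{w \<in> space P. \<forall>x\<in>sign_cube n. s < eucl_norm m (\<lambda>i. w (i, n)) + (\<Sum>j<n. x j * w (m, j))} \<in> sets P"
      using finite_sign_cube by measurable
  qed
  also have "\<dots> \<le> measure P {w \<in> space P. \<forall>x\<in>sign_cube n. s \<le> eucl_norm m (mat_vec n (\<lambda>i j. w (i, j)) x) + w (m, n)}"
    using sign_cube_unit[OF _ n] by (intro gordon_comparison finite_sign_cube)
  also have "{w \<in> space P. \<forall>x\<in>sign_cube n. s \<le> eucl_norm m (mat_vec n (\<lambda>i j. w (i, j)) x) + w (m, n)} =
      {w \<in> space P. s \<le> hopfield_min m n w + w (m, n)}"
    using hopfield_min_ge_iff[of "s - w (m, n)" m n w for w] by (auto simp: diff_le_eq)
  finally show ?thesis .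
qed

lemma hopfield_expectation_ge: "decoupled_mean \<le> integral\<^sup>L P (hopfield_min m n)"
proof -
  have X: "integrable P (hopfield_min m n)" by (rule integrable_hopfield_min) auto
  have g: "integrable P (\<lambda>w. w (m, n))" "integral\<^sup>L P (\<lambda>w. w (m, n)) = 0"
    using gauss_mean[of "(m, n)" "{..m} \<times> {..n}"] by auto
  have "integral\<^sup>L P decoupled \<le> integral\<^sup>L P (\<lambda>w. hopfield_min m n w + w (m, n))"
    using X g by (intro prob_space.expectation_mono_of_tail_mono[OF prob_space_gauss_prod] decoupled_expectation hopfield_tail_comparison) auto
  also have "\<dots> = integral\<^sup>L P (hopfield_min m n)" using X g by simp
  finally show ?thesis by (simp add: decoupled_expectation)
qed

text \<open>
  One \<open>t\<close> pays for the fluctuation of the decoupled minimum and the other for the extra variable \<open>g\<^sub>0\<close>, the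
  entry \<open>(m, n)\<close>: if the minimum is below \<open>c\<close>, then either \<open>g\<^sub>0\<close> is at least \<open>t\<close> or the sum is below \<open>c + t\<close>.
\<close>

lemma hopfield_deviation:
  assumes t: "t > 0" and c: "c \<le> decoupled_mean - 2 * t"
  shows "1 - 4 / t\<^sup>2 \<le> measure P {w \<in> space P. c \<le> hopfield_min m n w}"
proof -
  have [measurable]: "(\<lambda>w. w k) \<in> borel_measurable P" for k by (rule measurable_gauss_component)
  let ?g = "\<lambda>w :: nat \<times> nat \<Rightarrow> real. w (m, n)"
  have gauss: "measure P {w \<in> space P. t \<le> ?g w} \<le> 1 / t\<^sup>2"
  proof -
    have k: "(m, n) \<in> {..m} \<times> {..n}" by simp
    have "measure P {w \<in> space P. t \<le> ?g w} \<le> measure P {w \<in> space P. t\<^sup>2 \<le> (?g w)\<^sup>2}"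
      using t by (intro gauss_prod.P.finite_measure_mono) (auto intro: power_mono)
    also have "\<dots> \<le> integral\<^sup>L P (\<lambda>w. (?g w)\<^sup>2) / t\<^sup>2"
      using t gauss_square_moment(1)[OF k]
      by (intro integral_Markov_inequality_measure[where A = "{}"]) auto
    finally show ?thesis using gauss_square_moment(2)[OF k] by simp
  qed
  have low: "measure P {w \<in> space P. hopfield_min m n w + ?g w < c + t} \<le> 3 / t\<^sup>2"
  proof -
    have "measure P {w \<in> space P. hopfield_min m n w + ?g w < c + t} =
        1 - measure P {w \<in> space P. c + t \<le> hopfield_min m n w + ?g w}"
      by (subst gauss_prod.P.prob_neg[symmetric]) (auto simp: not_le)
    also have "\<dots> \<le> 1 - measure P {w \<in> space P. c + t < decoupled w}"
      using hopfield_tail_comparison[of "c + t"] by simp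
    also have "\<dots> = measure P {w \<in> space P. decoupled w \<le> c + t}"
      by (subst gauss_prod.P.prob_neg[symmetric]) (auto simp: not_less)
    also have "\<dots> \<le> measure P {w \<in> space P. decoupled w \<le> decoupled_mean - t}"
      using c by (intro gauss_prod.P.finite_measure_mono) auto
    also have "\<dots> \<le> 3 / t\<^sup>2" by (rule decoupled_deviation[OF t])
    finally show ?thesis .
  qed
  have "1 - measure P {w \<in> space P. c \<le> hopfield_min m n w} = measure P {w \<in> space P. hopfield_min m n w < c}"
    by (subst gauss_prod.P.prob_neg[symmetric]) (auto simp: not_le)
  also have "\<dots> \<le> measure P ({w \<in> space P. hopfield_min m n w + ?g w < c + t} \<union> {w \<in> space P. t \<le> ?g w})"
    by (intro gauss_prod.P.finite_measure_mono) auto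
  also have "\<dots> \<le> measure P {w \<in> space P. hopfield_min m n w + ?g w < c + t} + measure P {w \<in> space P. t \<le> ?g w}"
    by (intro measure_Un_le) auto
  also have "\<dots> \<le> 3 / t\<^sup>2 + 1 / t\<^sup>2" using low gauss by linarith
  finally show ?thesis by (simp add: field_simps)
qed

end

text \<open>
  Independence of the entries means that their joint law is the product of their laws. Outside the
  index set the variables are replaced by \<open>0\<close> in the proof, since nothing is known about their measurability there.
\<close>

lemma std_normal_matrix_distr:
  assumes H: "std_normal_matrix M m n H" and mn: "m \<ge> 1" "n \<ge> 1"
  defines "I \<equiv> {..<m} \<times> {..<n}"
  shows "(\<lambda>\<omega>. \<lambda>(i, j)\<in>I. H i j \<omega>) \<in> measurable M (gauss_prod I)"
    and "distr M (gauss_prod I) (\<lambda>\<omega>. \<lambda>(i, j)\<in>I. H i j \<omega>) = gauss_prod I"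
proof -
  interpret prob_space M using H by (simp add: std_normal_matrix_def)
  let ?X = "\<lambda>k. if k \<in> I then H (fst k) (snd k) else (\<lambda>_. 0)"
  have I: "I \<noteq> {}" using mn by (auto simp: I_def lessThan_empty_iff)
  have indep: "indep_vars (\<lambda>_. borel) (\<lambda>(i, j). H i j) I"
    and dist: "\<And>i j. i < m \<Longrightarrow> j < n \<Longrightarrow> distributed M lborel (H i j) std_normal_density"
    using H by (auto simp: std_normal_matrix_def I_def)
  have rv: "random_variable borel (?X k)" for k
    using dist[of "fst k" "snd k"] by (auto simp: I_def distributed_def)
  have law: "distr M borel (?X k) = std_gauss" if "k \<in> I" for k
  proof -
    have "distr M borel (?X k) = distr M lborel (H (fst k) (snd k))"
      using that by (intro distr_cong) auto
    also have "\<dots> = std_gauss"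
      using dist[of "fst k" "snd k"] that by (auto simp: I_def distributed_def std_gauss_def)
    finally show ?thesis .
  qed
  have "indep_vars (\<lambda>_. borel) ?X I"
    using indep by (rule indep_vars_cong[THEN iffD1, rotated -1]) (auto simp: case_prod_unfold)
  then have "distr M (\<Pi>\<^sub>M k\<in>I. borel) (\<lambda>\<omega>. \<lambda>k\<in>I. ?X k \<omega>) = (\<Pi>\<^sub>M k\<in>I. distr M borel (?X k))"
    using indep_vars_iff_distr_eq_PiM[where X = ?X, OF I rv] by blast
  also have "\<dots> = gauss_prod I" by (intro PiM_cong refl law)
  finally have D: "distr M (\<Pi>\<^sub>M k\<in>I. borel) (\<lambda>\<omega>. \<lambda>k\<in>I. ?X k \<omega>) = gauss_prod I" .
  have eq: "(\<lambda>\<omega>. \<lambda>(i, j)\<in>I. H i j \<omega>) = (\<lambda>\<omega>. \<lambda>k\<in>I. ?X k \<omega>)"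
    by (auto simp: fun_eq_iff restrict_def)
  show "(\<lambda>\<omega>. \<lambda>(i, j)\<in>I. H i j \<omega>) \<in> measurable M (gauss_prod I)"
    unfolding eq by (intro measurable_restrict, unfold measurable_std_gauss_iff) (rule rv)
  have "distr M (gauss_prod I) (\<lambda>\<omega>. \<lambda>(i, j)\<in>I. H i j \<omega>) = distr M (\<Pi>\<^sub>M k\<in>I. borel) (\<lambda>\<omega>. \<lambda>k\<in>I. ?X k \<omega>)"
    unfolding eq by (intro distr_cong sets_PiM_cong) auto
  with D show "distr M (gauss_prod I) (\<lambda>\<omega>. \<lambda>(i, j)\<in>I. H i j \<omega>) = gauss_prod I" by simp
qed

lemma std_normal_matrix_hopfield_min:
  fixes H :: "nat \<Rightarrow> nat \<Rightarrow> 'a \<Rightarrow> real"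
  assumes H: "std_normal_matrix M m n H" and mn: "m \<ge> 1" "n \<ge> 1"
  defines "\<xi> \<equiv> \<lambda>\<omega>. MIN x\<in>sign_cube n. eucl_norm m (mat_vec n (\<lambda>i j. H i j \<omega>) x)"
  shows "integrable M \<xi>"
    and "sqrt (real m) - 1 / (4 * sqrt (real m)) - sqrt (real n) * sqrt (2 / pi) \<le> (\<integral>\<omega>. \<xi> \<omega> \<partial>M)"
    and "\<lbrakk>t > 0; c \<le> sqrt (real m) - 1 / (4 * sqrt (real m)) - sqrt (real n) * sqrt (2 / pi) - 2 * t\<rbrakk> \<Longrightarrow>
      1 - 4 / t\<^sup>2 \<le> \<P>(\<omega> in M. c \<le> \<xi> \<omega>)"
proof -
  interpret gordon_pair m n using mn by unfold_locales
  let ?I = "{..<m} \<times> {..<n}"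
  let ?Z = "\<lambda>\<omega>. \<lambda>(i, j)\<in>?I. H i j \<omega>"
  have Z: "?Z \<in> measurable M (gauss_prod ?I)" and law: "distr M (gauss_prod ?I) ?Z = gauss_prod ?I"
    using std_normal_matrix_distr[OF H mn] by auto
  have sub: "finite ({..m} \<times> {..n})" "?I \<subseteq> {..m} \<times> {..n}" by auto
  have xi: "\<xi> \<omega> = hopfield_min m n (?Z \<omega>)" for \<omega>
  proof -
    have "eucl_norm m (mat_vec n (\<lambda>i j. H i j \<omega>) x) = eucl_norm m (mat_vec n (\<lambda>i j. ?Z \<omega> (i, j)) x)" for x
      unfolding eucl_norm_def mat_vec_def by (intro L2_set_cong sum.cong) auto
    then show ?thesis by (simp add: \<xi>_def hopfield_min_def)
  qed
  have transfer: "(\<integral>\<omega>. F (hopfield_min m n (?Z \<omega>)) \<partial>M) = integral\<^sup>L P (\<lambda>w. F (hopfield_min m n w))"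
    if F[measurable]: "F \<in> borel_measurable borel" for F :: "real \<Rightarrow> real"
  proof -
    have m1: "(\<lambda>w. F (hopfield_min m n w)) \<in> borel_measurable (gauss_prod ?I)" by measurable
    have "(\<integral>\<omega>. F (hopfield_min m n (?Z \<omega>)) \<partial>M) = (\<integral>w. F (hopfield_min m n w) \<partial>gauss_prod ?I)"
      using integral_distr[OF Z m1] by (simp only: law)
    also have "\<dots> = integral\<^sup>L P (\<lambda>w. F (hopfield_min m n w))"
      by (rule integral_gauss_prod_restrict(2)[OF sub m1, symmetric]) (simp add: hopfield_min_restrict)
    finally show ?thesis .
  qed
  have mean: "sqrt (real m) - 1 / (4 * sqrt (real m)) - sqrt (real n) * sqrt (2 / pi) \<le> decoupled_mean"
    using gauss_norm_expectation_lower[OF mn(1)] by (simp add: decoupled_mean_def)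
  have "integrable (distr M (gauss_prod ?I) ?Z) (hopfield_min m n)"
    unfolding law by (rule integrable_hopfield_min) simp
  then show "integrable M \<xi>"
    unfolding xi by (rule integrable_distr[OF Z])
  show "sqrt (real m) - 1 / (4 * sqrt (real m)) - sqrt (real n) * sqrt (2 / pi) \<le> (\<integral>\<omega>. \<xi> \<omega> \<partial>M)"
    unfolding xi using transfer[of "\<lambda>x. x"] mean hopfield_expectation_ge by simp
  assume t: "t > 0" and c: "c \<le> sqrt (real m) - 1 / (4 * sqrt (real m)) - sqrt (real n) * sqrt (2 / pi) - 2 * t"
  have "1 - 4 / t\<^sup>2 \<le> measure P {w \<in> space P. c \<le> hopfield_min m n w}"
    using t c mean by (intro hopfield_deviation) auto
  also have "\<dots> = integral\<^sup>L P (\<lambda>w. indicator {c..} (hopfield_min m n w))"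
  proof -
    have "integral\<^sup>L P (\<lambda>w. indicator {c..} (hopfield_min m n w)) =
        integral\<^sup>L P (indicator {w \<in> space P. c \<le> hopfield_min m n w})"
      by (intro Bochner_Integration.integral_cong) (auto simp: indicator_def)
    also have "\<dots> = measure P ({w \<in> space P. c \<le> hopfield_min m n w} \<inter> space P)" by simp
    also have "{w \<in> space P. c \<le> hopfield_min m n w} \<inter> space P = {w \<in> space P. c \<le> hopfield_min m n w}" by auto
    finally show ?thesis by (rule sym)
  qed
  also have "\<dots> = (\<integral>\<omega>. indicator {c..} (hopfield_min m n (?Z \<omega>)) \<partial>M)"
    by (rule transfer[symmetric]) simp
  also have "\<dots> = (\<integral>\<omega>. indicator {\<omega> \<in> space M. c \<le> \<xi> \<omega>} \<omega> \<partial>M)"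
    by (intro Bochner_Integration.integral_cong) (auto simp: indicator_def xi)
  also have "\<dots> = measure M ({\<omega> \<in> space M. c \<le> \<xi> \<omega>} \<inter> space M)" by simp
  also have "{\<omega> \<in> space M. c \<le> \<xi> \<omega>} \<inter> space M = {\<omega> \<in> space M. c \<le> \<xi> \<omega>}" by auto
  finally show "1 - 4 / t\<^sup>2 \<le> \<P>(\<omega> in M. c \<le> \<xi> \<omega>)" .
qed

theorem lemma9:
  fixes \<alpha> eps1m eps1n eps5g :: real
    and m :: "nat \<Rightarrow> nat"
    and M :: "nat \<Rightarrow> 'a measure"
    and H :: "nat \<Rightarrow> nat \<Rightarrow> nat \<Rightarrow> 'a \<Rightarrow> real"
    and \<xi> :: "nat \<Rightarrow> 'a \<Rightarrow> real"
    and \<xi>l :: "nat \<Rightarrow> real"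
  assumes alpha_pos: "\<alpha> > 0"
    and rows: "\<And>n. int (m n) = \<lceil>\<alpha> * real n\<rceil>"
    and gaussian: "\<And>n. std_normal_matrix (M n) (m n) n (H n)"
    and xi: "\<And>n \<omega>. \<xi> n \<omega> =
      (MIN x\<in>sign_cube n. eucl_norm (m n) (mat_vec n (\<lambda>i j. H n i j \<omega>) x))"
    and eps_pos: "eps1m > 0" "eps1n > 0" "eps5g > 0"
    and xi_l: "\<forall>\<^sub>F n in sequentially.
      (1 - eps1m) * sqrt \<alpha> - (1 + eps1n) * sqrt (2 / pi) - eps5g > \<xi>l n / sqrt (real n)"
  shows
    "((\<lambda>n. \<P>(\<omega> in M n.
         (MIN x\<in>sign_cube n. eucl_norm (m n) (mat_vec n (\<lambda>i j. H n i j \<omega>) x)) \<ge> \<xi>l n))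
       \<longlonglongrightarrow> 1) \<and>
     (((\<lambda>n. \<P>(\<omega> in M n.
         (MIN x\<in>sign_cube n. eucl_norm (m n) (mat_vec n (\<lambda>i j. H n i j \<omega>) x)) \<ge> \<xi>l n))
       \<longlonglongrightarrow> 1)
       \<longleftrightarrow> ((\<lambda>n. \<P>(\<omega> in M n. \<xi> n \<omega> \<ge> \<xi>l n)) \<longlonglongrightarrow> 1)) \<and>
     ((\<forall>\<^sub>F n in sequentially. \<xi>l n \<ge> 0) \<longrightarrow>
       (((\<lambda>n. \<P>(\<omega> in M n. \<xi> n \<omega> \<ge> \<xi>l n)) \<longlonglongrightarrow> 1)
         \<longleftrightarrow> ((\<lambda>n. \<P>(\<omega> in M n. (\<xi> n \<omega>)\<^sup>2 \<ge> (\<xi>l n)\<^sup>2)) \<longlonglongrightarrow> 1))) \<and>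
     (\<forall>n\<ge>1. integrable (M n) (\<xi> n) \<and>
       (\<integral>\<omega>. \<xi> n \<omega> \<partial>M n) / sqrt (real n) =
         (\<integral>\<omega>. (MIN x\<in>sign_cube n. eucl_norm (m n) (mat_vec n (\<lambda>i j. H n i j \<omega>) x)) \<partial>M n)
           / sqrt (real n) \<and>
       (\<integral>\<omega>. \<xi> n \<omega> \<partial>M n) / sqrt (real n) \<ge>
         sqrt \<alpha> - 1 / (4 * sqrt (real (m n) * real n)) - sqrt (2 / pi))"
proof -
  have n_le_m: "\<alpha> * real n \<le> real (m n)" for n
    using rows[of n] le_of_int_ceiling[of "\<alpha> * real n"] by (metis of_int_of_nat_eq)
  have m_pos: "m n \<ge> 1" if "n \<ge> 1" for n
  proof -
    have "0 < \<alpha> * real n" using alpha_pos that by simp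
    with n_le_m[of n] have "real (m n) > 0" by linarith
    then show ?thesis by simp
  qed
  define lo where "lo n = sqrt (real (m n)) - 1 / (4 * sqrt (real (m n))) - sqrt (real n) * sqrt (2 / pi)" for n
  note gordon = std_normal_matrix_hopfield_min[OF gaussian m_pos, unfolded xi[symmetric], folded lo_def]
  have \<xi>_nonneg: "0 \<le> \<xi> n \<omega>" for n \<omega>
    using hopfield_min_nonneg[of "m n" n "\<lambda>(i, j). H n i j \<omega>"] by (simp add: xi hopfield_min_def)
  have root_ratio: "sqrt \<alpha> * sqrt (real n) \<le> sqrt (real (m n))" for n
    using n_le_m[of n] by (simp add: real_sqrt_mult[symmetric])

  have expectation: "sqrt \<alpha> - 1 / (4 * sqrt (real (m n) * real n)) - sqrt (2 / pi) \<le>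
      (\<integral>\<omega>. \<xi> n \<omega> \<partial>M n) / sqrt (real n)" if n: "n \<ge> 1" for n
  proof -
    have "sqrt \<alpha> \<le> sqrt (real (m n)) / sqrt (real n)"
      using root_ratio[of n] n by (simp add: pos_le_divide_eq)
    then have "sqrt \<alpha> - 1 / (4 * sqrt (real (m n) * real n)) - sqrt (2 / pi) \<le> lo n / sqrt (real n)"
      using n by (simp add: lo_def diff_divide_distrib real_sqrt_mult)
    also have "\<dots> \<le> (\<integral>\<omega>. \<xi> n \<omega> \<partial>M n) / sqrt (real n)"
      using gordon(2)[OF n n] by (intro divide_right_mono) auto
    finally show ?thesis .
  qed

  have limit: "(\<lambda>n. \<P>(\<omega> in M n. \<xi> n \<omega> \<ge> \<xi>l n)) \<longlonglongrightarrow> 1"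
  proof -
    \<comment> \<open>The margin \<open>eps5g * sqrt n = 4 * \<delta> * sqrt n\<close> is split in two halves: one for the deviation with
        \<open>t = \<delta> * sqrt n\<close>, and one that absorbs the term \<open>1 / (4 * sqrt m) \<le> 1 / 4\<close> for large \<open>n\<close>.\<close>
    define \<delta> where "\<delta> = eps5g / 4"
    have \<delta>: "\<delta> > 0" using eps_pos by (simp add: \<delta>_def)
    have "filterlim (\<lambda>n. sqrt (real n)) at_top sequentially"
      by (rule filterlim_compose[OF sqrt_at_top filterlim_real_sequentially])
    then have large: "\<forall>\<^sub>F n in sequentially. 1 / (8 * \<delta>) \<le> sqrt (real n)"
      by (simp add: filterlim_at_top)
    have "\<forall>\<^sub>F n in sequentially. 1 - 4 / \<delta>\<^sup>2 * inverse (real n) \<le> \<P>(\<omega> in M n. \<xi> n \<omega> \<ge> \<xi>l n)"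
      using xi_l large eventually_ge_at_top[of 1]
    proof eventually_elim
      case (elim n)
      define q where "q = sqrt (real n)"
      have q: "q > 0" using elim(3) by (simp add: q_def)
      have "\<xi>l n / q < sqrt \<alpha> - sqrt (2 / pi) - 4 * \<delta>"
      proof -
        have "eps1m * sqrt \<alpha> \<ge> 0" "eps1n * sqrt (2 / pi) \<ge> 0" using eps_pos alpha_pos by auto
        then show ?thesis using elim(1) by (simp add: q_def \<delta>_def algebra_simps)
      qed
      then have "\<xi>l n < (sqrt \<alpha> - sqrt (2 / pi) - 4 * \<delta>) * q" using q by (simp add: pos_divide_less_eq)
      also have "\<dots> = sqrt \<alpha> * q - q * sqrt (2 / pi) - 4 * (\<delta> * q)" by (simp add: algebra_simps)
      also have "\<dots> \<le> lo n - 2 * (\<delta> * q)"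
      proof -
        have "1 / (4 * sqrt (real (m n))) \<le> 1 / 4"
          using m_pos[OF elim(3)] by (simp add: divide_le_eq)
        moreover have "1 / 4 \<le> 2 * (\<delta> * q)" using elim(2) \<delta> by (simp add: q_def field_simps)
        ultimately show ?thesis using root_ratio[of n] unfolding lo_def q_def by linarith
      qed
      finally have "1 - 4 / (\<delta> * q)\<^sup>2 \<le> \<P>(\<omega> in M n. \<xi>l n \<le> \<xi> n \<omega>)"
        using \<delta> q by (intro gordon(3)[OF elim(3) elim(3)]) auto
      moreover have "4 / (\<delta> * q)\<^sup>2 = 4 / \<delta>\<^sup>2 * inverse (real n)"
        by (simp add: power_mult_distrib q_def divide_inverse mult_ac)
      ultimately show ?case by simp
    qed
    moreover have "\<forall>\<^sub>F n in sequentially. \<P>(\<omega> in M n. \<xi> n \<omega> \<ge> \<xi>l n) \<le> 1"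
      using gaussian by (intro always_eventually allI prob_space.prob_le_1) (simp add: std_normal_matrix_def)
    moreover have "(\<lambda>n. 1 - 4 / \<delta>\<^sup>2 * inverse (real n)) \<longlonglongrightarrow> 1 - 4 / \<delta>\<^sup>2 * 0"
      by (intro tendsto_intros LIMSEQ_inverse_real_of_nat tendsto_inverse_0_at_top filterlim_real_sequentially)
    then have "(\<lambda>n. 1 - 4 / \<delta>\<^sup>2 * inverse (real n)) \<longlonglongrightarrow> 1" by simp
    ultimately show ?thesis by (rule tendsto_sandwich[OF _ _ _ tendsto_const])
  qed

  have squares: "((\<lambda>n. \<P>(\<omega> in M n. \<xi> n \<omega> \<ge> \<xi>l n)) \<longlonglongrightarrow> 1) \<longleftrightarrow>
      ((\<lambda>n. \<P>(\<omega> in M n. (\<xi> n \<omega>)\<^sup>2 \<ge> (\<xi>l n)\<^sup>2)) \<longlonglongrightarrow> 1)"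
    if "\<forall>\<^sub>F n in sequentially. \<xi>l n \<ge> 0"
  proof (rule tendsto_cong)
    show "\<forall>\<^sub>F n in sequentially. \<P>(\<omega> in M n. \<xi> n \<omega> \<ge> \<xi>l n) = \<P>(\<omega> in M n. (\<xi> n \<omega>)\<^sup>2 \<ge> (\<xi>l n)\<^sup>2)"
      using that by eventually_elim (simp add: \<xi>_nonneg)
  qed
  show ?thesis
    unfolding xi[symmetric] using limit squares gordon(1) expectation by blast
qed

end
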